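(* Let $(P,\omega)$ be a canonically labeled sign-graded poset of rank $r$ with $p=|P|$, and write $W(P,\omega;t)=\sum_{i=0}^{\lfloor d/2\rfloor}a_i(P,\omega)t^i(1+t)^{d-2i}$ with $d=p-r-1$. If $r=0$ then $$W(P,\omega;t)=2^{-p+1}(1+t)^{p-1}\,\overline{W}\big(P,\omega;4t(1+t)^{-2}\big),$$ equivalently $a_i(P,\omega)=2^{-p+1+2i}\,|\{\pi\in\mathcal{L}(P,\omega):\operatorname{peak}(\pi)=i\}|$. If $r=1$ then $$W(P,\omega;t)=2^{-p}t^{-1}(1+t)^{p}\,\overline{W}\big(\hat P,\hat\omega;4t(1+t)^{-2}\big),$$ equivalently $a_i(P,\omega)=2^{-p+2+2i}\,|\{\pi\in\mathcal{L}(\hat P,\hat\omega):\operatorname{peak}(\pi)=i+1\}|$, where $\hat P$ is $P$ with a greatest element adjoined and $\hat\omega$ is any canonical labeling of $\hat P$.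
   Context: A labeled poset is a finite poset $P$ with an injection $\omega:P\to\mathbb{Z}$. Its Jordan–Hölder set $\mathcal{L}(P,\omega)$ is the set of words $\pi=a_1\cdots a_p$ that are permutations of $\omega(P)$ such that $x<_Py$ implies $\omega(x)$ precedes $\omega(y)$. For a cover relation $x\lessdot y$ let $\epsilon(x,y)=1$ if $\omega(x)<\omega(y)$ and $-1$ otherwise. $(P,\omega)$ is sign-graded if for every maximal chain $x_1<\cdots<x_k$ the sum $\sum_{i=2}^k\epsilon(x_{i-1},x_i)$ is the same; this value $r$ is the rank, and $\rho(x)$ is the analogous sum along any saturated chain from a minimal element to $x$. A labeling is canonical if the labeled poset is sign-graded, $\rho$ takes values in $\{0,1\}$, rank-$0$ elements have negative labels and rank-$1$ elements positive labels. For $\pi=a_1\cdots a_p$: $\operatorname{des}(\pi)=|\{i\in[p-1]:a_i>a_{i+1}\}|$, $\operatorname{peak}(\pi)=|\{2\le i\le p-1:a_{i-1}<a_i>a_{i+1}\}|$. $W(P,\omega;t)=\sum_{\pi\in\mathcal{L}(P,\omega)}t^{\operatorname{des}(\pi)}$ and $\overline{W}(P,\omega;t)=\sum_{\pi\in\mathcal{L}(P,\omega)}t^{\operatorname{peak}(\pi)}$. *)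

theory Defs
  imports Complex_Main
begin

definition poset_on :: "'a set \<Rightarrow> ('a \<Rightarrow> 'a \<Rightarrow> bool) \<Rightarrow> bool" where
  "poset_on P le \<longleftrightarrow>
     (\<forall>x\<in>P. le x x) \<and>
     (\<forall>x\<in>P. \<forall>y\<in>P. le x y \<and> le y x \<longrightarrow> x = y) \<and>
     (\<forall>x\<in>P. \<forall>y\<in>P. \<forall>z\<in>P. le x y \<and> le y z \<longrightarrow> le x z)"

definition lt_on :: "('a \<Rightarrow> 'a \<Rightarrow> bool) \<Rightarrow> 'a \<Rightarrow> 'a \<Rightarrow> bool" where
  "lt_on le x y \<longleftrightarrow> le x y \<and> x \<noteq> y"

definition covers :: "'a set \<Rightarrow> ('a \<Rightarrow> 'a \<Rightarrow> bool) \<Rightarrow> 'a \<Rightarrow> 'a \<Rightarrow> bool" where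
  "covers P le x y \<longleftrightarrow> x \<in> P \<and> y \<in> P \<and> lt_on le x y \<and>
     \<not> (\<exists>z\<in>P. lt_on le x z \<and> lt_on le z y)"

definition minimal_in :: "'a set \<Rightarrow> ('a \<Rightarrow> 'a \<Rightarrow> bool) \<Rightarrow> 'a \<Rightarrow> bool" where
  "minimal_in P le x \<longleftrightarrow> x \<in> P \<and> \<not> (\<exists>y\<in>P. lt_on le y x)"

definition maximal_in :: "'a set \<Rightarrow> ('a \<Rightarrow> 'a \<Rightarrow> bool) \<Rightarrow> 'a \<Rightarrow> bool" where
  "maximal_in P le x \<longleftrightarrow> x \<in> P \<and> \<not> (\<exists>y\<in>P. lt_on le x y)"

definition sat_chain_from_min :: "'a set \<Rightarrow> ('a \<Rightarrow> 'a \<Rightarrow> bool) \<Rightarrow> 'a list \<Rightarrow> bool" where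
  "sat_chain_from_min P le xs \<longleftrightarrow> xs \<noteq> [] \<and> minimal_in P le (hd xs) \<and>
     (\<forall>i. Suc i < length xs \<longrightarrow> covers P le (xs ! i) (xs ! Suc i))"

definition maximal_chain :: "'a set \<Rightarrow> ('a \<Rightarrow> 'a \<Rightarrow> bool) \<Rightarrow> 'a list \<Rightarrow> bool" where
  "maximal_chain P le xs \<longleftrightarrow> sat_chain_from_min P le xs \<and> maximal_in P le (last xs)"

definition eps :: "('a \<Rightarrow> int) \<Rightarrow> 'a \<Rightarrow> 'a \<Rightarrow> int" where
  "eps om x y = (if om x < om y then 1 else -1)"

definition chain_sum :: "('a \<Rightarrow> int) \<Rightarrow> 'a list \<Rightarrow> int" where
  "chain_sum om xs = (\<Sum>i<length xs - 1. eps om (xs ! i) (xs ! Suc i))"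

definition labeled_poset :: "'a set \<Rightarrow> ('a \<Rightarrow> 'a \<Rightarrow> bool) \<Rightarrow> ('a \<Rightarrow> int) \<Rightarrow> bool" where
  "labeled_poset P le om \<longleftrightarrow> finite P \<and> poset_on P le \<and> inj_on om P"

definition sign_graded :: "'a set \<Rightarrow> ('a \<Rightarrow> 'a \<Rightarrow> bool) \<Rightarrow> ('a \<Rightarrow> int) \<Rightarrow> int \<Rightarrow> bool" where
  "sign_graded P le om r \<longleftrightarrow> (\<forall>xs. maximal_chain P le xs \<longrightarrow> chain_sum om xs = r)"

text \<open>Canonical labeling: sign-graded, rho in {0,1}, rank-0 elements negative labels,
  rank-1 elements positive labels. rho x is the chain sum of any saturated chain
  from a minimal element to x.\<close>
definition canonical :: "'a set \<Rightarrow> ('a \<Rightarrow> 'a \<Rightarrow> bool) \<Rightarrow> ('a \<Rightarrow> int) \<Rightarrow> bool" where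
  "canonical P le om \<longleftrightarrow> labeled_poset P le om \<and> (\<exists>r. sign_graded P le om r) \<and>
     (\<forall>xs. sat_chain_from_min P le xs \<longrightarrow>
        (chain_sum om xs = 0 \<and> om (last xs) < 0) \<or> (chain_sum om xs = 1 \<and> om (last xs) > 0))"

definition JH :: "'a set \<Rightarrow> ('a \<Rightarrow> 'a \<Rightarrow> bool) \<Rightarrow> ('a \<Rightarrow> int) \<Rightarrow> int list set" where
  "JH P le om = {\<pi>. distinct \<pi> \<and> set \<pi> = om ` P \<and>
     (\<forall>x\<in>P. \<forall>y\<in>P. lt_on le x y \<longrightarrow>
        (\<exists>i j. i < j \<and> j < length \<pi> \<and> \<pi> ! i = om x \<and> \<pi> ! j = om y))}"

definition des :: "int list \<Rightarrow> nat" where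
  "des \<pi> = card {i. Suc i < length \<pi> \<and> \<pi> ! i > \<pi> ! Suc i}"

definition peak :: "int list \<Rightarrow> nat" where
  "peak \<pi> = card {i. 1 \<le> i \<and> Suc i < length \<pi> \<and> \<pi> ! (i - 1) < \<pi> ! i \<and> \<pi> ! i > \<pi> ! Suc i}"

definition W :: "'a set \<Rightarrow> ('a \<Rightarrow> 'a \<Rightarrow> bool) \<Rightarrow> ('a \<Rightarrow> int) \<Rightarrow> real \<Rightarrow> real" where
  "W P le om t = (\<Sum>\<pi>\<in>JH P le om. t ^ des \<pi>)"

definition Wbar :: "'a set \<Rightarrow> ('a \<Rightarrow> 'a \<Rightarrow> bool) \<Rightarrow> ('a \<Rightarrow> int) \<Rightarrow> real \<Rightarrow> real" where
  "Wbar P le om t = (\<Sum>\<pi>\<in>JH P le om. t ^ peak \<pi>)"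

definition hatP :: "'a set \<Rightarrow> 'a option set" where
  "hatP P = insert None (Some ` P)"

definition hatle :: "('a \<Rightarrow> 'a \<Rightarrow> bool) \<Rightarrow> 'a option \<Rightarrow> 'a option \<Rightarrow> bool" where
  "hatle le x y \<longleftrightarrow> y = None \<or> (\<exists>a b. x = Some a \<and> y = Some b \<and> le a b)"

end

theory Submission
  imports Defs "HOL-Combinatorics.Multiset_Permutations"
begin

text \<open>
  For a canonical labeling, the two ends of a cover relation have labels of opposite sign. Hence a
  maximal run of letters of equal sign in a word of the Jordan--Hoelder set consists of pairwise
  incomparable elements, and its letters may be rearranged freely: the Jordan--Hoelder set is a
  disjoint union of products of symmetric groups, one factor for each run. Both statistics split
  over the runs. A run of negative letters lies between larger letters (or ends of the word), so it
  contributes its interior peaks, while a run of positive letters lies between smaller letters.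
  For a single run, splitting a permutation at its maximum (negative run) or its minimum (positive
  run) gives the same recursion for the descent sum as for the peak sum.

  In rank 1, adjoining a greatest element with a negative label multiplies the W-polynomial by t,
  and the sum over the words of a run depends only on the size of the run, which makes the
  choice of the canonical labeling of the extended poset irrelevant.
\<close>

section \<open>Descents and peaks of words\<close>

text \<open>Splitting off the index 0 turns statistics defined as cardinalities of index sets into
  recursions along the list.\<close>

lemma card_Collect_shift:
  fixes Q :: "nat \<Rightarrow> bool"
  assumes "finite {i. Q (Suc i)}"
  shows "card {i. Q i} = of_bool (Q 0) + card {i. Q (Suc i)}"
proof -
  have "{i. Q i} = (if Q 0 then {0} else {}) \<union> Suc ` {i. Q (Suc i)}"
    by (auto simp: image_iff) (metis not0_implies_Suc)+
  moreover have "card (Suc ` {i. Q (Suc i)}) = card {i. Q (Suc i)}"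
    by (rule card_image) simp
  ultimately show ?thesis
    using assms by (auto simp: card_insert_if)
qed

lemma des_Nil [simp]: "des [] = 0"
  and des_single [simp]: "des [x] = 0"
  by (simp_all add: des_def)

lemma des_Cons_Cons [simp]: "des (x # y # zs) = of_bool (y < x) + des (y # zs)"
proof -
  have "finite {i. Suc (Suc i) < length (x # y # zs) \<and> (x # y # zs) ! Suc (Suc i) < (x # y # zs) ! Suc i}"
    by (rule finite_subset[of _ "{..length zs}"]) auto
  from card_Collect_shift[OF this] show ?thesis
    unfolding des_def by simp
qed

lemma des_append:
  "u \<noteq> [] \<Longrightarrow> v \<noteq> [] \<Longrightarrow> des (u @ v) = des u + of_bool (hd v < last u) + des v"
proof (induction u rule: induct_list012)
  case (2 x)
  then show ?case by (cases v) auto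
qed auto

text \<open>The Booleans record whether the word is entered by an ascent and left by a descent.\<close>

fun ctx_peak :: "bool \<Rightarrow> int list \<Rightarrow> bool \<Rightarrow> nat" where
  "ctx_peak l [] r = 0"
| "ctx_peak l [x] r = of_bool (l \<and> r)"
| "ctx_peak l (x # y # zs) r = of_bool (l \<and> y < x) + ctx_peak (x < y) (y # zs) r"

lemma peak_short [simp]: "peak [] = 0" "peak [x] = 0" "peak [x, y] = 0"
  by (simp_all add: peak_def)

lemma peak_Cons3:
  "peak (x # y # z # zs) = of_bool (x < y \<and> z < y) + peak (y # z # zs)"
proof -
  let ?Q = "\<lambda>xs i. 1 \<le> i \<and> Suc i < length xs \<and> xs ! (i - 1) < xs ! i \<and> xs ! i > xs ! Suc i"
  have fin1: "finite {i. ?Q xs (Suc i)}" and fin2: "finite {i. ?Q xs (Suc (Suc i))}" for xs :: "int list"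
    by (rule finite_subset[of _ "{..length xs}"]; auto)+
  have 1: "card {i. ?Q (x # y # z # zs) i} = card {i. ?Q (x # y # z # zs) (Suc i)}"
    using card_Collect_shift[of "?Q (x # y # z # zs)", OF fin1] by simp
  have 2: "\<dots> = of_bool (x < y \<and> z < y) + card {i. ?Q (x # y # z # zs) (Suc (Suc i))}"
    using card_Collect_shift[of "\<lambda>i. ?Q (x # y # z # zs) (Suc i)", OF fin2] by simp
  have 3: "card {i. ?Q (y # z # zs) i} = card {i. ?Q (y # z # zs) (Suc i)}"
    using card_Collect_shift[of "?Q (y # z # zs)", OF fin1] by simp
  have 4: "{i. ?Q (x # y # z # zs) (Suc (Suc i))} = {i. ?Q (y # z # zs) (Suc i)}"
    by auto
  show ?thesis
    unfolding peak_def 1 2 3 4 ..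
qed

lemma peak_eq_ctx_peak: "peak xs = ctx_peak False xs False"
proof (induction xs rule: induct_list012)
  case (3 x y zs)
  then show ?case by (cases zs) (simp_all add: peak_Cons3)
qed auto

text \<open>The comparison across the seam serves twice: as the right flag of \<open>u\<close> and
  as the left flag of \<open>v\<close>.\<close>

lemma ctx_peak_append:
  "u \<noteq> [] \<Longrightarrow> v \<noteq> [] \<Longrightarrow>
    ctx_peak l (u @ v) r = ctx_peak l u (hd v < last u) + ctx_peak (last u < hd v) v r"
proof (induction u arbitrary: l rule: induct_list012)
  case (2 x)
  then show ?case by (cases v) auto
qed auto

text \<open>A set flag acts as an extra smaller letter at that end. Peaks are never adjacent and
  never at an end of the extended word, so \<open>k\<close> peaks require \<open>k + 1\<close>
  further letters. This is what keeps the exponents of \<open>peak_weight\<close> from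
  truncating.\<close>

lemma ctx_peak_le:
  "xs \<noteq> [] \<Longrightarrow> 2 * ctx_peak l xs r + 1 \<le> length xs + of_bool l + of_bool r"
proof (induction xs arbitrary: l rule: induct_list012)
  case (3 x y zs)
  from "3.IH"(2)[of "x < y"] show ?case by (cases "x < y") auto
qed auto

text \<open>With smaller neighbours assumed at both ends, the maximal letter is a peak.\<close>

lemma ctx_peak_pos: "xs \<noteq> [] \<Longrightarrow> distinct xs \<Longrightarrow> 1 \<le> ctx_peak True xs True"
proof (induction xs rule: induct_list012)
  case (3 x y zs)
  then show ?case by (cases "x < y") auto
qed auto

text \<open>
  The exponents are chosen such that the weight is multiplicative over runs; the power of \<^term>\<open>t\<close>
  drops by one for a positive run, whose leading factor \<^term>\<open>t\<close> is the descent that leaves it.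
  On nonempty words with distinct letters the subtractions do not truncate.
\<close>

definition peak_weight :: "real \<Rightarrow> bool \<Rightarrow> bool \<Rightarrow> int list \<Rightarrow> real" where
  "peak_weight t l r xs =
     ((1 + t) / 2) ^ (length xs + of_bool l + of_bool r - 1 - 2 * ctx_peak l xs r) *
     t ^ (ctx_peak l xs r - of_bool (l \<and> r))"

text \<open>The ascent at the seam sets the left flag of \<open>v\<close>, and this flag cancels the
  \<open>- 1\<close> in the exponent of \<open>v\<close>; hence the exponents add.\<close>

lemma peak_weight_append_ascent:
  assumes "u \<noteq> []" "v \<noteq> []" "last u < hd v"
  shows "peak_weight t False False (u @ v) = peak_weight t False False u * peak_weight t True False v"
proof -
  have p: "ctx_peak False (u @ v) False = ctx_peak False u False + ctx_peak True v False"
    using assms by (simp add: ctx_peak_append)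
  have "length (u @ v) - 1 - 2 * (ctx_peak False u False + ctx_peak True v False) =
      (length u - 1 - 2 * ctx_peak False u False) + (length v - 2 * ctx_peak True v False)"
    using ctx_peak_le[OF assms(1), of False False] ctx_peak_le[OF assms(2), of True False] by simp
  then show ?thesis
    by (simp add: peak_weight_def p power_add)
qed

text \<open>With both flags set, the power of \<open>t\<close> in the weight of \<open>u\<close> is
  one less than its number of peaks; the explicit factor \<open>t\<close> restores it.\<close>

lemma peak_weight_append_descent:
  assumes "u \<noteq> []" "v \<noteq> []" "hd v < last u" "distinct u"
  shows "peak_weight t True False (u @ v) = peak_weight t True True u * t * peak_weight t False False v"
proof -
  have p: "ctx_peak True (u @ v) False = ctx_peak True u True + ctx_peak False v False"
    using assms by (simp add: ctx_peak_append)
  have e: "length (u @ v) - 2 * (ctx_peak True u True + ctx_peak False v False) =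
      (length u + 1 - 2 * ctx_peak True u True) + (length v - 1 - 2 * ctx_peak False v False)"
    using ctx_peak_le[OF assms(1), of True True] ctx_peak_le[OF assms(2), of False False] by simp
  obtain k where k: "ctx_peak True u True = Suc k"
    using ctx_peak_pos[OF assms(1,4)] by (cases "ctx_peak True u True") auto
  show ?thesis
    using e by (simp add: peak_weight_def p k power_add)
qed

section \<open>Sums over the permutations of a single run\<close>

lemma sum_permutations_split:
  assumes "finite S" "m \<in> S"
  shows "(\<Sum>\<sigma>\<in>permutations_of_set S. f \<sigma>) =
    (\<Sum>U\<in>Pow (S - {m}). \<Sum>u\<in>permutations_of_set U.
       \<Sum>v\<in>permutations_of_set (S - {m} - U). f (u @ m # v))"
proof -
  let ?X = "SIGMA U:Pow (S - {m}). permutations_of_set U \<times> permutations_of_set (S - {m} - U)"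
  have "(\<Sum>U\<in>Pow (S - {m}). \<Sum>u\<in>permutations_of_set U.
       \<Sum>v\<in>permutations_of_set (S - {m} - U). f (u @ m # v)) =
      (\<Sum>(U, u, v)\<in>?X. f (u @ m # v))"
    using assms(1) by (simp add: sum.Sigma sum.cartesian_product split_def)
  also have "\<dots> = (\<Sum>\<sigma>\<in>permutations_of_set S. f \<sigma>)"
  \<comment> \<open>A permutation is cut at its unique letter \<open>m\<close>; \<open>U\<close> is
    the set of letters to the left of \<open>m\<close>.\<close>
  proof (rule sum.reindex_bij_witness
      [where i = "\<lambda>\<sigma>. (set (takeWhile (\<lambda>x. x \<noteq> m) \<sigma>), takeWhile (\<lambda>x. x \<noteq> m) \<sigma>, tl (dropWhile (\<lambda>x. x \<noteq> m) \<sigma>))"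
        and j = "\<lambda>(U, u, v). u @ m # v"])
    fix x assume "x \<in> ?X"
    then obtain U u v where x: "x = (U, u, v)" "U \<subseteq> S - {m}" "set u = U" "distinct u"
        "set v = S - {m} - U" "distinct v"
      by (auto simp: permutations_of_set_def)
    have *: "\<forall>y\<in>set u. y \<noteq> m"
      using x by auto
    then have tw: "takeWhile (\<lambda>x. x \<noteq> m) (u @ m # v) = u" "dropWhile (\<lambda>x. x \<noteq> m) (u @ m # v) = m # v"
      by (simp_all add: takeWhile_append2 dropWhile_append2)
    show "(set (takeWhile (\<lambda>x. x \<noteq> m) (case x of (U, u, v) \<Rightarrow> u @ m # v)),
        takeWhile (\<lambda>x. x \<noteq> m) (case x of (U, u, v) \<Rightarrow> u @ m # v),
        tl (dropWhile (\<lambda>x. x \<noteq> m) (case x of (U, u, v) \<Rightarrow> u @ m # v))) = x"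
      using x by (simp add: tw)
    show "(case x of (U, u, v) \<Rightarrow> u @ m # v) \<in> permutations_of_set S"
      using x assms by (auto simp: permutations_of_set_def)
    show "f (case x of (U, u, v) \<Rightarrow> u @ m # v) = (case x of (U, u, v) \<Rightarrow> f (u @ m # v))"
      by (simp add: split_def)
  next
    fix \<sigma> assume "\<sigma> \<in> permutations_of_set S"
    then have \<sigma>: "set \<sigma> = S" "distinct \<sigma>"
      by (auto simp: permutations_of_set_def)
    then obtain u v where uv: "\<sigma> = u @ m # v"
      using assms split_list by metis
    then have *: "\<forall>y\<in>set u. y \<noteq> m"
      using \<sigma> by auto
    then have tw: "takeWhile (\<lambda>x. x \<noteq> m) \<sigma> = u" "dropWhile (\<lambda>x. x \<noteq> m) \<sigma> = m # v"
      by (simp_all add: uv takeWhile_append2 dropWhile_append2)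
    show "(case (set (takeWhile (\<lambda>x. x \<noteq> m) \<sigma>), takeWhile (\<lambda>x. x \<noteq> m) \<sigma>, tl (dropWhile (\<lambda>x. x \<noteq> m) \<sigma>))
        of (U, u, v) \<Rightarrow> u @ m # v) = \<sigma>"
      by (simp add: tw) (simp add: uv)
    show "(set (takeWhile (\<lambda>x. x \<noteq> m) \<sigma>), takeWhile (\<lambda>x. x \<noteq> m) \<sigma>, tl (dropWhile (\<lambda>x. x \<noteq> m) \<sigma>)) \<in> ?X"
      unfolding tw using \<sigma> uv by (auto simp: permutations_of_set_def)
  qed
  finally show ?thesis ..
qed

definition perm_sum :: "('a list \<Rightarrow> real) \<Rightarrow> 'a set \<Rightarrow> real" where
  "perm_sum f S = (\<Sum>\<sigma>\<in>permutations_of_set S. f \<sigma>)"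

text \<open>One step of the common recursion: \<open>S\<close> is a run without its pivot and
  \<open>U\<close> the part left of the pivot. The pivot in first and in last position together
  yield the term \<open>(1 + t) * F S\<close>; for a one-letter run nothing is left and the value is
  1.\<close>

definition split_step :: "real \<Rightarrow> ('a set \<Rightarrow> real) \<Rightarrow> 'a set \<Rightarrow> real" where
  "split_step t F S = (if S = {} then 1
     else (1 + t) * F S + t * (\<Sum>U\<in>Pow S - {{}, S}. F U * F (S - U)))"

text \<open>The factors \<open>a\<close> (pivot first) and \<open>b\<close> (pivot last) enter only
  through their sum. So a statistic that treats the two ends differently can share its recursion
  with one that treats them alike.\<close>

lemma perm_sum_split_step:
  fixes f :: "'a list \<Rightarrow> real"
  assumes S: "finite S" "m \<in> S" and ab: "a + b = 1 + t"
    and f1: "f [m] = 1"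
    and fa: "\<And>v. v \<noteq> [] \<Longrightarrow> distinct (m # v) \<Longrightarrow> set (m # v) = S \<Longrightarrow> f (m # v) = a * f v"
    and fb: "\<And>u. u \<noteq> [] \<Longrightarrow> distinct (u @ [m]) \<Longrightarrow> set (u @ [m]) = S \<Longrightarrow> f (u @ [m]) = b * f u"
    and ft: "\<And>u v. u \<noteq> [] \<Longrightarrow> v \<noteq> [] \<Longrightarrow> distinct (u @ m # v) \<Longrightarrow> set (u @ m # v) = S \<Longrightarrow>
      f (u @ m # v) = t * (f u * f v)"
  shows "perm_sum f S = split_step t (perm_sum f) (S - {m})"
proof -
  let ?S = "S - {m}"
  let ?h = "\<lambda>U. \<Sum>u\<in>permutations_of_set U. \<Sum>v\<in>permutations_of_set (?S - U). f (u @ m # v)"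
  have main: "perm_sum f S = (\<Sum>U\<in>Pow ?S. ?h U)"
    unfolding perm_sum_def by (rule sum_permutations_split[OF S])
  show ?thesis
  proof (cases "?S = {}")
    case True
    show ?thesis
      unfolding main True by (simp add: split_step_def f1)
  next
    case False
    \<comment> \<open>The empty set puts \<open>m\<close> first and \<open>?S\<close> puts it last;
      these are two different terms because \<open>?S\<close> is nonempty.\<close>
    have "Pow ?S = insert {} (insert ?S (Pow ?S - {{}, ?S}))"
      by auto
    then have "(\<Sum>U\<in>Pow ?S. ?h U) = (\<Sum>U\<in>insert {} (insert ?S (Pow ?S - {{}, ?S})). ?h U)"
      by simp
    also have "\<dots> = ?h {} + (?h ?S + (\<Sum>U\<in>Pow ?S - {{}, ?S}. ?h U))"
      using S(1) False[symmetric] by (simp only: sum.insert finite_insert finite_Diff finite_Pow_iff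
          insert_iff Diff_iff singleton_iff simp_thms)
    also have "?h {} = a * perm_sum f ?S"
    proof -
      have "f (m # v) = a * f v" if "v \<in> permutations_of_set ?S" for v
      proof (rule fa)
        show "v \<noteq> []" "distinct (m # v)" "set (m # v) = S"
          using permutations_of_setD[OF that] S(2) False by (fastforce, simp, fastforce)
      qed
      then show ?thesis
        by (simp add: perm_sum_def sum_distrib_left)
    qed
    also have "?h ?S = b * perm_sum f ?S"
    proof -
      have "f (u @ [m]) = b * f u" if "u \<in> permutations_of_set ?S" for u
      proof (rule fb)
        show "u \<noteq> []" "distinct (u @ [m])" "set (u @ [m]) = S"
          using permutations_of_setD[OF that] S(2) False by (fastforce, simp, fastforce)
      qed
      then show ?thesis
        by (simp add: perm_sum_def sum_distrib_left)
    qed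
    also have "(\<Sum>U\<in>Pow ?S - {{}, ?S}. ?h U) =
        t * (\<Sum>U\<in>Pow ?S - {{}, ?S}. perm_sum f U * perm_sum f (?S - U))"
      unfolding sum_distrib_left
    proof (rule sum.cong[OF refl])
      fix U assume U: "U \<in> Pow ?S - {{}, ?S}"
      have "f (u @ m # v) = t * (f u * f v)"
        if "u \<in> permutations_of_set U" "v \<in> permutations_of_set (?S - U)" for u v
        using U that S by (intro ft) (auto simp: permutations_of_set_def)
      then have "?h U = (\<Sum>u\<in>permutations_of_set U. \<Sum>v\<in>permutations_of_set (?S - U). t * (f u * f v))"
        by (intro sum.cong) auto
      then show "?h U = t * (perm_sum f U * perm_sum f (?S - U))"
        unfolding perm_sum_def sum_product by (simp add: sum_distrib_left)
    qed
    finally show ?thesis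
      using False ab by (simp add: main split_step_def flip: distrib_right add.assoc)
  qed
qed

text \<open>Strong induction on the cardinality. A bijection between the letters left after removing
  the pivots matches the subsets in the two recursions, so the solution depends on the size of the
  set alone, and \<open>F\<close> and \<open>G\<close> may use unrelated pivots.\<close>

lemma split_step_unique:
  assumes F: "\<And>S. finite S \<Longrightarrow> S \<noteq> {} \<Longrightarrow> \<exists>m\<in>S. F S = split_step t F (S - {m})"
    and G: "\<And>S. finite S \<Longrightarrow> S \<noteq> {} \<Longrightarrow> \<exists>m\<in>S. G S = split_step t G (S - {m})"
    and "finite S" "S \<noteq> {}" "finite T" "card S = card T"
  shows "F S = G T"
  using assms(3-)
proof (induction "card S" arbitrary: S T rule: less_induct)
  case less
  then have "T \<noteq> {}" by auto
  obtain m n where m: "m \<in> S" "F S = split_step t F (S - {m})"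
    and n: "n \<in> T" "G T = split_step t G (T - {n})"
    using F[OF less.prems(1,2)] G[OF less.prems(3) \<open>T \<noteq> {}\<close>] by blast
  let ?S = "S - {m}" and ?T = "T - {n}"
  have c: "card ?S = card ?T" "card ?S < card S"
    using m(1) n(1) less.prems card_Diff1_less[of S m] by simp_all
  show ?case
  proof (cases "?S = {}")
    case True
    then have "?T = {}"
      using c(1) less.prems by (metis card.empty card_eq_0_iff finite_Diff)
    show ?thesis
      unfolding m(2) n(2) True \<open>?T = {}\<close> by (simp add: split_step_def)
  next
    case False
    then have F': "?T \<noteq> {}"
      using c(1) less.prems by (metis card.empty card_eq_0_iff finite_Diff)
    obtain g where g: "bij_betw g ?S ?T"
      using c(1) less.prems finite_same_card_bij by (metis finite_Diff)
    have inj: "inj_on g ?S" and img: "g ` ?S = ?T"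
      using g by (auto simp: bij_betw_def)
    have 1: "F ?S = G ?T"
      using less.hyps[OF c(2)] False less.prems c(1) by simp
    have bij: "bij_betw ((`) g) (Pow ?S - {{}, ?S}) (Pow ?T - {{}, ?T})"
    proof -
      have "bij_betw ((`) g) (Pow ?S) (Pow ?T)"
        using g by (rule bij_betw_Pow)
      moreover have "bij_betw ((`) g) {{}, ?S} {{}, ?T}"
        using img False F' by (auto simp: bij_betw_def inj_on_def)
      ultimately show ?thesis
        by (rule bij_betw_DiffI) auto
    qed
    have "(\<Sum>U\<in>Pow ?T - {{}, ?T}. G U * G (?T - U)) =
        (\<Sum>U\<in>Pow ?S - {{}, ?S}. G (g ` U) * G (?T - g ` U))"
      using bij by (rule sum.reindex_bij_betw[symmetric])
    also have "\<dots> = (\<Sum>U\<in>Pow ?S - {{}, ?S}. F U * F (?S - U))"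
    proof (rule sum.cong[OF refl])
      fix U assume U: "U \<in> Pow ?S - {{}, ?S}"
      have fin: "finite ?S" using less.prems by simp
      have sub: "U \<subset> ?S" "?S - U \<subset> ?S" "U \<noteq> {}" "?S - U \<noteq> {}"
        using U by auto
      have img2: "?T - g ` U = g ` (?S - U)"
        using inj_on_image_set_diff[OF inj, of ?S U] U img by auto
      \<comment> \<open>Both factors of each summand belong to proper nonempty subsets, whose images
        under \<open>g\<close> have the same size.\<close>
      have "F V = G (g ` V)" if "V \<subset> ?S" "V \<noteq> {}" for V
      proof (rule less.hyps)
        show "card V < card S"
          using psubset_card_mono[OF fin that(1)] c(2) by simp
        show "finite V" "finite (g ` V)"
          using fin that(1) finite_subset by blast+
        show "card V = card (g ` V)"
          using inj that(1) by (metis card_image inj_on_subset psubset_imp_subset)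
      qed (fact that(2))
      then show "G (g ` U) * G (?T - g ` U) = F U * F (?S - U)"
        unfolding img2 using sub by simp
    qed
    finally show ?thesis
      unfolding m(2) n(2) split_step_def if_not_P[OF False] if_not_P[OF F'] 1 by (rule arg_cong[OF sym])
  qed
qed

text \<open>The pivot is the maximum: it is entered by an ascent and left by a descent. In first
  position it costs a factor \<open>t\<close>, in last position nothing.\<close>

lemma perm_sum_des_split:
  assumes "finite S" "S \<noteq> {}"
  shows "\<exists>m\<in>S. perm_sum (\<lambda>\<sigma>. t ^ des \<sigma>) S = split_step t (perm_sum (\<lambda>\<sigma>. t ^ des \<sigma>)) (S - {m})"
proof (intro bexI[of _ "Max S"] perm_sum_split_step[where a = t and b = 1])
  let ?m = "Max S"
  show "?m \<in> S" "?m \<in> S" "finite S"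
    using assms by auto
  have gr: "x < ?m" if "x \<in> S" "x \<noteq> ?m" for x
    using assms that by (metis Max_ge order_le_less)
  show "t ^ des (?m # v) = t * t ^ des v" if "v \<noteq> []" "distinct (?m # v)" "set (?m # v) = S" for v
    using that gr[of "hd v"] des_append[of "[?m]" v] by (cases v) auto
  show "t ^ des (u @ [?m]) = 1 * t ^ des u" if "u \<noteq> []" "distinct (u @ [?m])" "set (u @ [?m]) = S" for u
  proof -
    have "last u < ?m" using that by (intro gr) (auto dest: last_in_set)
    then show ?thesis using that by (simp add: des_append)
  qed
  show "t ^ des (u @ ?m # v) = t * (t ^ des u * t ^ des v)"
    if "u \<noteq> []" "v \<noteq> []" "distinct (u @ ?m # v)" "set (u @ ?m # v) = S" for u v
  proof -
    have "last u < ?m" "hd v < ?m" using that by (auto intro!: gr dest: last_in_set hd_in_set)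
    then show ?thesis
      using that des_append[of "[?m]" v] by (simp add: des_append power_add)
  qed
qed simp_all

text \<open>The pivot is the maximum for a run between larger letters (\<open>b\<close> false) and
  the minimum for a run between smaller ones (\<open>b\<close> true). The two parts then see the
  same flags as the whole run. A pivot at either end is no peak and costs one factor
  \<open>(1 + t) / 2\<close>.\<close>

lemma perm_sum_peak_weight_split:
  assumes "finite S" "S \<noteq> {}"
  shows "\<exists>m\<in>S. perm_sum (peak_weight t b b) S = split_step t (perm_sum (peak_weight t b b)) (S - {m})"
proof (intro bexI[of _ "if b then Min S else Max S"]
    perm_sum_split_step[where a = "(1 + t) / 2" and b = "(1 + t) / 2"])
  let ?m = "if b then Min S else Max S" and ?s = "(1 + t) / 2"
  show "?m \<in> S" "?m \<in> S" "finite S"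
    using assms by auto
  show "?s + ?s = 1 + t" by simp
  have gr: "if b then ?m < x else x < ?m" if "x \<in> S" "x \<noteq> ?m" for x
    using assms that by (auto simp: order_le_less dest: Max_ge[of S x] Min_le[of S x])
  show "peak_weight t b b [?m] = 1"
    by (simp add: peak_weight_def)
  show "peak_weight t b b (?m # v) = ?s * peak_weight t b b v"
    if "v \<noteq> []" "distinct (?m # v)" "set (?m # v) = S" for v
  proof -
    have "if b then ?m < hd v else hd v < ?m"
      using that by (intro gr) (auto dest: hd_in_set)
    then have "ctx_peak b (?m # v) b = ctx_peak b v b"
      using that ctx_peak_append[of "[?m]" v b b] by (cases b) auto
    moreover have "length (?m # v) + of_bool b + of_bool b - 1 - 2 * ctx_peak b v b =
       Suc (length v + of_bool b + of_bool b - 1 - 2 * ctx_peak b v b)"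
      using ctx_peak_le[OF that(1), of b b] by simp
    ultimately show ?thesis
      by (simp add: peak_weight_def)
  qed
  show "peak_weight t b b (u @ [?m]) = ?s * peak_weight t b b u"
    if "u \<noteq> []" "distinct (u @ [?m])" "set (u @ [?m]) = S" for u
  proof -
    have "if b then ?m < last u else last u < ?m"
      using that by (intro gr) (auto dest: last_in_set)
    then have "ctx_peak b (u @ [?m]) b = ctx_peak b u b"
      using that ctx_peak_append[of u "[?m]" b b] by (cases b) auto
    moreover have "length (u @ [?m]) + of_bool b + of_bool b - 1 - 2 * ctx_peak b u b =
       Suc (length u + of_bool b + of_bool b - 1 - 2 * ctx_peak b u b)"
      using ctx_peak_le[OF that(1), of b b] by simp
    ultimately show ?thesis
      by (simp add: peak_weight_def)
  qed
  show "peak_weight t b b (u @ ?m # v) = t * (peak_weight t b b u * peak_weight t b b v)"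
    if uv: "u \<noteq> []" "v \<noteq> []" "distinct (u @ ?m # v)" "set (u @ ?m # v) = S" for u v
  proof -
    have "if b then ?m < last u else last u < ?m" "if b then ?m < hd v else hd v < ?m"
      using uv by (intro gr; auto dest: last_in_set hd_in_set)+
    then have p: "ctx_peak b (u @ ?m # v) b = ctx_peak b u b + ctx_peak b v b + of_bool (\<not> b)"
      using uv ctx_peak_append[of u "?m # v" b b] ctx_peak_append[of "[?m]" v _ b] by (cases b) auto
    have le: "2 * ctx_peak b u b + 1 \<le> length u + of_bool b + of_bool b"
      "2 * ctx_peak b v b + 1 \<le> length v + of_bool b + of_bool b"
      using ctx_peak_le uv(1,2) by blast+
    have e: "length (u @ ?m # v) + of_bool b + of_bool b - 1 - 2 * (ctx_peak b u b + ctx_peak b v b + of_bool (\<not> b)) =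
       (length u + of_bool b + of_bool b - 1 - 2 * ctx_peak b u b) +
       (length v + of_bool b + of_bool b - 1 - 2 * ctx_peak b v b)"
      using le by (cases b) auto
    \<comment> \<open>One power of \<open>t\<close> is gained in either case: an interior maximum is
      itself a new peak, while at an interior minimum the two parts lower their exponents by one
      each and the whole run only once.\<close>
    have "ctx_peak b u b + ctx_peak b v b + of_bool (\<not> b) - of_bool b =
        Suc ((ctx_peak b u b - of_bool b) + (ctx_peak b v b - of_bool b))"
      using ctx_peak_pos[of u] ctx_peak_pos[of v] uv by (cases b) auto
    then show ?thesis
      unfolding peak_weight_def p e conj_absorb by (simp only: power_add power_Suc mult_ac)
  qed
qed

text \<open>Two sets of equal size are allowed so that descents can be read in one labeling and
  peaks in another.\<close>

lemma perm_sum_des_eq_peak_weight: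
  assumes "finite S" "S \<noteq> {}" "finite T" "card S = card T"
  shows "perm_sum (\<lambda>\<sigma>. t ^ des \<sigma>) S = perm_sum (peak_weight t b b) T"
  using split_step_unique[OF perm_sum_des_split perm_sum_peak_weight_split assms] .

section \<open>Runs of constant sign\<close>

text \<open>For \<open>Cs = runs s ys\<close> with distinct \<open>ys\<close>, these are the words
  obtained from \<open>ys\<close> by permuting letters inside its runs.\<close>

fun words :: "'a set list \<Rightarrow> 'a list set" where
  "words [] = {[]}"
| "words (S # Cs) = (\<lambda>(v, w). v @ w) ` (permutations_of_set S \<times> words Cs)"

text \<open>Runs are stored as sets, which forgets the order inside each run; this makes the fibres
  of \<open>runs\<close> products of symmetric groups.\<close>

function runs :: "('a \<Rightarrow> bool) \<Rightarrow> 'a list \<Rightarrow> 'a set list" where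
  "runs s [] = []"
| "runs s (x # xs) = insert x (set (takeWhile (\<lambda>y. s y = s x) xs)) # runs s (dropWhile (\<lambda>y. s y = s x) xs)"
  by pat_completeness auto
termination
  by (relation "measure (length \<circ> snd)") (auto simp: less_Suc_eq_le length_dropWhile_le)

text \<open>The base case forces the last run to have sign \<^term>\<open>True\<close>.\<close>

fun alternating :: "('a \<Rightarrow> bool) \<Rightarrow> bool \<Rightarrow> 'a set list \<Rightarrow> bool" where
  "alternating s b [] = (\<not> b)"
| "alternating s b (S # Cs) = (finite S \<and> S \<noteq> {} \<and> (\<forall>x\<in>S. s x = b) \<and> alternating s (\<not> b) Cs)"

lemma set_words: "xs \<in> words Cs \<Longrightarrow> set xs \<subseteq> \<Union>(set Cs)"
proof (induction Cs arbitrary: xs)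
  case (Cons S Cs)
  then obtain v w where "xs = v @ w" "set v = S" "w \<in> words Cs"
    by (auto simp: permutations_of_set_def)
  then show ?case
    using Cons.IH[of w] by auto
qed simp

lemma runs_append:
  assumes "v \<noteq> []" "\<And>x. x \<in> set v \<Longrightarrow> s x = b" "w = [] \<or> s (hd w) \<noteq> b"
  shows "runs s (v @ w) = set v # runs s w"
proof -
  obtain x xs where v: "v = x # xs"
    using assms(1) by (cases v) auto
  have "takeWhile (\<lambda>y. s y = b) (xs @ w) = xs @ takeWhile (\<lambda>y. s y = b) w"
    "dropWhile (\<lambda>y. s y = b) (xs @ w) = dropWhile (\<lambda>y. s y = b) w"
    using assms(2) v by (simp_all add: takeWhile_append2 dropWhile_append2)
  moreover have "takeWhile (\<lambda>y. s y = b) w = []" "dropWhile (\<lambda>y. s y = b) w = w"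
    using assms(3) by (cases w; auto)+
  ultimately show ?thesis
    using assms(2)[of x] v by simp
qed

text \<open>Induction that peels off the first run. The condition on \<open>w\<close> says that the
  run is maximal, and the equation for \<open>runs\<close> is supplied to the step for
  unfolding.\<close>

lemma run_induct [case_names Nil run]:
  fixes s :: "'a \<Rightarrow> bool"
  assumes "Q []"
    and step: "\<And>v w b. v \<noteq> [] \<Longrightarrow> (\<And>x. x \<in> set v \<Longrightarrow> s x = b) \<Longrightarrow> w = [] \<or> s (hd w) \<noteq> b \<Longrightarrow>
      runs s (v @ w) = set v # runs s w \<Longrightarrow> Q w \<Longrightarrow> Q (v @ w)"
  shows "Q xs"
proof (induction "length xs" arbitrary: xs rule: less_induct)
  case less
  show ?case
  proof (cases xs)
    case Nil
    then show ?thesis using assms(1) by simp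
  next
    case (Cons x ys)
    let ?v = "takeWhile (\<lambda>y. s y = s x) xs" and ?w = "dropWhile (\<lambda>y. s y = s x) xs"
    have v: "?v \<noteq> []" "\<And>y. y \<in> set ?v \<Longrightarrow> s y = s x"
      using Cons by (auto dest: set_takeWhileD)
    have w: "?w = [] \<or> s (hd ?w) \<noteq> s x"
      using hd_dropWhile[of "\<lambda>y. s y = s x" xs] by blast
    have "length ?w < length xs"
      using Cons by (simp add: less_Suc_eq_le length_dropWhile_le)
    then have "Q ?w"
      by (rule less)
    with v w have "Q (?v @ ?w)"
      by (intro step[where b = "s x"] runs_append[where b = "s x"])
    then show ?thesis
      by simp
  qed
qed

lemma in_words_runs: "distinct xs \<Longrightarrow> xs \<in> words (runs s xs)"
proof (induction xs rule: run_induct[where s = s])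
  case (run v w b)
  then have "v \<in> permutations_of_set (set v)" "w \<in> words (runs s w)"
    by auto
  then show ?case
    by (subst run(4)) auto
qed simp

lemma hd_words: "alternating s b Cs \<Longrightarrow> xs \<in> words Cs \<Longrightarrow> xs = [] \<or> s (hd xs) = b"
  by (cases Cs) (auto simp: permutations_of_set_def hd_append)

text \<open>Neighbouring blocks are nonempty and have opposite signs, so no two of them can merge
  into one run.\<close>

lemma runs_words: "alternating s b Cs \<Longrightarrow> xs \<in> words Cs \<Longrightarrow> runs s xs = Cs"
proof (induction Cs arbitrary: b xs)
  case (Cons S Cs)
  then obtain v w where vw: "xs = v @ w" "v \<in> permutations_of_set S" "w \<in> words Cs"
    by auto
  have "runs s (v @ w) = set v # runs s w"
  proof (rule runs_append)
    show "v \<noteq> []" "\<And>x. x \<in> set v \<Longrightarrow> s x = b"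
      using vw(2) Cons.prems(1) by (auto dest: permutations_of_setD)
    show "w = [] \<or> s (hd w) \<noteq> b"
      using hd_words[OF _ vw(3), of s "\<not> b"] Cons.prems(1) by auto
  qed
  then show ?case
    using vw Cons.IH[OF _ vw(3), of "\<not> b"] Cons.prems(1) by (auto dest: permutations_of_setD)
qed simp

text \<open>Maximality of the runs makes the sign flip from each run to the next; the sign of the
  last letter settles the base case.\<close>

lemma alternating_runs: "xs \<noteq> [] \<Longrightarrow> s (last xs) \<Longrightarrow> alternating s (s (hd xs)) (runs s xs)"
proof (induction xs rule: run_induct[where s = s])
  case (run v w b)
  have hd: "s (hd v) = b"
    using run by simp
  have "alternating s (\<not> b) (runs s w)"
  proof (cases "w = []")
    case True
    then have "s (last v)"
      using run by simp
    then show ?thesis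
      using True run by simp
  next
    case False
    then show ?thesis
      using run by (cases b) auto
  qed
  then show ?case
    using run(1,2) hd by (simp add: run(4))
qed simp

lemma words_runs_rearrangement:
  "xs \<in> words (runs s ys) \<Longrightarrow> distinct ys \<Longrightarrow> distinct xs \<and> set xs = set ys"
proof (induction ys arbitrary: xs rule: run_induct[where s = s])
  case (run v w b)
  from run.prems(1) obtain v' w' where "xs = v' @ w'" "v' \<in> permutations_of_set (set v)" "w' \<in> words (runs s w)"
    by (auto simp: run(4))
  then show ?case
    using run.IH[of w'] run.prems(2) by (auto dest: permutations_of_setD)
qed simp

text \<open>Related letters of equal sign have a letter of the other sign between them in
  \<open>L\<close>, and this letter would have to interrupt their run. Hence letters of one run are
  unrelated, and permuting them violates nothing.\<close>

lemma sorted_wrt_words_runs: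
  assumes "xs \<in> words (runs s ys)" "distinct ys" "sorted_wrt (\<lambda>x y. \<not> L y x) ys"
    and "\<And>x y. x \<in> set ys \<Longrightarrow> y \<in> set ys \<Longrightarrow> L x y \<Longrightarrow> s x = s y \<Longrightarrow>
      \<exists>z\<in>set ys. L x z \<and> L z y \<and> s z \<noteq> s x"
  shows "sorted_wrt (\<lambda>x y. \<not> L y x) xs"
  using assms
proof (induction ys arbitrary: xs rule: run_induct[where s = s])
  case (run v w b)
  note srt = run.prems(3)[unfolded sorted_wrt_append]
  from run.prems(1) obtain v' w' where vw: "xs = v' @ w'" "v' \<in> permutations_of_set (set v)" "w' \<in> words (runs s w)"
    by (auto simp: run(4))
  have set: "set v' = set v" "set w' = set w"
    using vw words_runs_rearrangement[OF vw(3)] run.prems(2) by (auto dest: permutations_of_setD)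
  have "\<not> L y x" if xy: "x \<in> set v" "y \<in> set v" for x y
  proof
    assume "L y x"
    \<comment> \<open>By its sign \<open>z\<close> is not in \<open>v\<close>, so it stands in
      \<open>w\<close>, after \<open>x\<close>, which contradicts \<open>L z x\<close>.\<close>
    then obtain z where z: "z \<in> set (v @ w)" "L y z" "L z x" "s z \<noteq> s y"
      using run.prems(4)[of y x] run(2)[OF xy(1)] run(2)[OF xy(2)] xy by auto
    then show False
      using run(2) xy srt by auto
  qed
  then have "sorted_wrt (\<lambda>x y. \<not> L y x) v'"
    by (intro sorted_wrt_mono_rel[OF _ sorted_wrt_true]) (simp add: set)
  moreover have "sorted_wrt (\<lambda>x y. \<not> L y x) w'"
  proof (rule run.IH[OF vw(3)])
    fix x y assume xy: "x \<in> set w" "y \<in> set w" "L x y" "s x = s y"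
    \<comment> \<open>Since \<open>x\<close> is in \<open>w\<close>, the relation
      \<open>L x z\<close> keeps \<open>z\<close> out of \<open>v\<close>.\<close>
    then obtain z where "z \<in> set (v @ w)" "L x z" "L z y" "s z \<noteq> s x"
      using run.prems(4)[of x y] by auto
    then show "\<exists>z\<in>set w. L x z \<and> L z y \<and> s z \<noteq> s x"
      using srt xy by auto
  qed (use srt run.prems(2) in auto)
  ultimately show ?case
    using srt by (simp add: vw(1) sorted_wrt_append set)
qed simp

text \<open>All permutations of \<open>S\<close> have the same length, so a concatenation determines
  its two parts and the sum factors.\<close>

lemma sum_words_Cons:
  fixes f :: "'a list \<Rightarrow> real"
  assumes "\<And>v w. v \<in> permutations_of_set S \<Longrightarrow> w \<in> words Cs \<Longrightarrow> f (v @ w) = g v * h w"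
  shows "(\<Sum>xs\<in>words (S # Cs). f xs) = (\<Sum>v\<in>permutations_of_set S. g v) * (\<Sum>w\<in>words Cs. h w)"
proof -
  have "inj_on (\<lambda>(v, w). v @ w) (permutations_of_set S \<times> words Cs)"
  proof (rule inj_onI, clarify)
    fix v w v' w' assume vw: "v \<in> permutations_of_set S" "v' \<in> permutations_of_set S" "v @ w = v' @ w'"
    have "length v = length v'"
      using vw(1,2) by (simp add: length_finite_permutations_of_set)
    then show "v = v' \<and> w = w'"
      using vw(3) by simp
  qed
  then have "(\<Sum>xs\<in>words (S # Cs). f xs) = (\<Sum>(v, w)\<in>permutations_of_set S \<times> words Cs. f (v @ w))"
    by (simp add: sum.reindex o_def split_def)
  also have "\<dots> = (\<Sum>(v, w)\<in>permutations_of_set S \<times> words Cs. g v * h w)"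
    using assms by (intro sum.cong) auto
  finally show ?thesis
    by (simp add: sum_product sum.cartesian_product)
qed

lemma perm_sum_image:
  assumes "inj_on om S"
  shows "perm_sum f (om ` S) = (\<Sum>v\<in>permutations_of_set S. f (map om v))"
proof -
  have "permutations_of_set (om ` S) = map om ` permutations_of_set S"
    using assms by (rule permutations_of_set_image_inj)
  moreover have "inj_on (map om) (permutations_of_set S)"
    by (rule inj_onI, rule map_inj_on) (use assms in \<open>auto simp: permutations_of_set_def\<close>)
  ultimately show ?thesis
    by (simp add: perm_sum_def sum.reindex)
qed

text \<open>Induction on the runs, where \<open>s\<close> marks the negative letters. The left flag
  is \<open>\<not> b\<close> because a positive run is entered by an ascent from a negative one. The
  two labelings share their signs, which fix every comparison between neighbouring runs; inside a
  run only its size counts.\<close>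

lemma sum_words_des_eq_peak_weight:
  assumes "alternating s b Cs"
    and "\<And>x. x \<in> \<Union>(set Cs) \<Longrightarrow> if s x then om1 x < 0 \<and> om2 x < 0 else 0 < om1 x \<and> 0 < om2 x"
    and "inj_on om1 (\<Union>(set Cs))" "inj_on om2 (\<Union>(set Cs))"
  shows "(\<Sum>xs\<in>words Cs. t ^ des (map om1 xs)) = (\<Sum>xs\<in>words Cs. peak_weight t (\<not> b) False (map om2 xs))"
  using assms
proof (induction Cs arbitrary: b)
  case Nil
  then show ?case by (simp add: peak_weight_def)
next
  case (Cons S Cs)
  have S: "finite S" "S \<noteq> {}" "\<And>x. x \<in> S \<Longrightarrow> s x = b" and alt: "alternating s (\<not> b) Cs"
    using Cons.prems(1) by auto
  have inj: "inj_on om1 S" "inj_on om2 S"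
    using Cons.prems(3,4) by (auto intro: inj_on_subset)
  have IH: "(\<Sum>xs\<in>words Cs. t ^ des (map om1 xs)) = (\<Sum>xs\<in>words Cs. peak_weight t b False (map om2 xs))"
    using Cons.IH[OF alt] Cons.prems(2-4) by (auto simp: inj_on_Un)
  have "(\<Sum>v\<in>permutations_of_set S. t ^ des (map om1 v)) = (\<Sum>v\<in>permutations_of_set S. peak_weight t (\<not> b) (\<not> b) (map om2 v))"
    using perm_sum_des_eq_peak_weight[of "om1 ` S" "om2 ` S" t "\<not> b"] S inj
    by (simp add: perm_sum_image card_image)
  note run = this
  have cross: "w = [] \<or> (if b then om1 (last v) < om1 (hd w) \<and> om2 (last v) < om2 (hd w)
      else om1 (hd w) < om1 (last v) \<and> om2 (hd w) < om2 (last v))"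
    and v: "v \<noteq> []" "distinct (map om2 v)"
    if "v \<in> permutations_of_set S" "w \<in> words Cs" for v w
  proof -
    show ne: "v \<noteq> []"
      using that(1) S(2) by (auto dest: permutations_of_setD)
    show "distinct (map om2 v)"
      using that(1) inj by (auto simp: distinct_map dest: permutations_of_setD)
    have "last v \<in> S"
      using that(1) ne by (auto dest: permutations_of_setD)
    then have 1: "if b then om1 (last v) < 0 \<and> om2 (last v) < 0 else 0 < om1 (last v) \<and> 0 < om2 (last v)"
      using Cons.prems(2)[of "last v"] S(3) by auto
    have 2: "if b then 0 < om1 (hd w) \<and> 0 < om2 (hd w) else om1 (hd w) < 0 \<and> om2 (hd w) < 0" if "w \<noteq> []"
    proof -
      have "hd w \<in> \<Union>(set (S # Cs))"
        using set_words[OF \<open>w \<in> words Cs\<close>] hd_in_set[OF that] by auto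
      then show ?thesis
        using Cons.prems(2)[of "hd w"] hd_words[OF alt \<open>w \<in> words Cs\<close>] that by auto
    qed
    show "w = [] \<or> (if b then om1 (last v) < om1 (hd w) \<and> om2 (last v) < om2 (hd w)
      else om1 (hd w) < om1 (last v) \<and> om2 (hd w) < om2 (last v))"
      using 1 2 by (cases "w = []") (auto split: if_splits)
  qed
  \<comment> \<open>The last run is negative, so a positive run is always left by a descent.\<close>
  have "w \<noteq> []" if "\<not> b" "w \<in> words Cs" for w
    using alt that by (cases Cs) (auto dest: permutations_of_setD)
  note ne = this
  show ?case
  proof (cases b)
    case True
    have "(\<Sum>xs\<in>words (S # Cs). t ^ des (map om1 xs)) =
        (\<Sum>v\<in>permutations_of_set S. t ^ des (map om1 v)) * (\<Sum>w\<in>words Cs. t ^ des (map om1 w))"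
    proof (rule sum_words_Cons)
      fix v w assume vw: "v \<in> permutations_of_set S" "w \<in> words Cs"
      show "t ^ des (map om1 (v @ w)) = t ^ des (map om1 v) * t ^ des (map om1 w)"
        using cross[OF vw] v[OF vw] True
        by (cases "w = []") (auto simp: des_append hd_map last_map power_add)
    qed
    also have "\<dots> = (\<Sum>xs\<in>words (S # Cs). peak_weight t False False (map om2 xs))"
      unfolding run IH
    proof (rule sum_words_Cons[symmetric])
      fix v w assume vw: "v \<in> permutations_of_set S" "w \<in> words Cs"
      show "peak_weight t False False (map om2 (v @ w)) =
          peak_weight t (\<not> b) (\<not> b) (map om2 v) * peak_weight t b False (map om2 w)"
      proof (cases "w = []")
        case True
        then show ?thesis using \<open>b\<close> by (simp add: peak_weight_def)
      next
        case False
        then show ?thesis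
          using cross[OF vw] v[OF vw] \<open>b\<close> peak_weight_append_ascent[of "map om2 v" "map om2 w" t]
          by (simp add: hd_map last_map)
      qed
    qed
    finally show ?thesis using True by simp
  next
    case False
    \<comment> \<open>The descent from the positive run to the next one is charged to the remaining
      word as a factor \<open>t\<close>.\<close>
    have "(\<Sum>xs\<in>words (S # Cs). t ^ des (map om1 xs)) =
        (\<Sum>v\<in>permutations_of_set S. t ^ des (map om1 v)) * (\<Sum>w\<in>words Cs. t * t ^ des (map om1 w))"
    proof (rule sum_words_Cons)
      fix v w assume vw: "v \<in> permutations_of_set S" "w \<in> words Cs"
      show "t ^ des (map om1 (v @ w)) = t ^ des (map om1 v) * (t * t ^ des (map om1 w))"
        using cross[OF vw] v[OF vw] ne[OF _ vw(2)] False
        by (auto simp: des_append hd_map last_map power_add)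
    qed
    also have "\<dots> = (\<Sum>v\<in>permutations_of_set S. peak_weight t True True (map om2 v)) *
        (\<Sum>w\<in>words Cs. t * peak_weight t False False (map om2 w))"
      using run IH False by (simp flip: sum_distrib_left)
    also have "\<dots> = (\<Sum>xs\<in>words (S # Cs). peak_weight t True False (map om2 xs))"
    proof (rule sum_words_Cons[symmetric])
      fix v w assume vw: "v \<in> permutations_of_set S" "w \<in> words Cs"
      show "peak_weight t True False (map om2 (v @ w)) =
          peak_weight t True True (map om2 v) * (t * peak_weight t False False (map om2 w))"
        using cross[OF vw] v[OF vw] ne[OF _ vw(2)] False
          peak_weight_append_descent[of "map om2 v" "map om2 w" t]
        by (simp add: hd_map last_map)
    qed
    finally show ?thesis using False by simp
  qed
qed

section \<open>Linear extensions and canonical labelings\<close>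

text \<open>Words in the elements instead of the labels give several labelings a common index
  set.\<close>

definition lin_ext :: "'a set \<Rightarrow> ('a \<Rightarrow> 'a \<Rightarrow> bool) \<Rightarrow> 'a list set" where
  "lin_ext P le = {xs. distinct xs \<and> set xs = P \<and> sorted_wrt (\<lambda>x y. \<not> lt_on le y x) xs}"

lemma finite_lin_ext: "finite P \<Longrightarrow> finite (lin_ext P le)"
  by (rule finite_subset[OF _ finite_permutations_of_set[of P]])
    (auto simp: lin_ext_def permutations_of_set_def)

lemma JH_eq_image_lin_ext:
  assumes "inj_on om P"
  shows "JH P le om = map om ` lin_ext P le"
proof (intro equalityI subsetI)
  fix ws assume "ws \<in> JH P le om"
  then have ws: "distinct ws" "set ws = om ` P"
    and ord: "\<And>x y. x \<in> P \<Longrightarrow> y \<in> P \<Longrightarrow> lt_on le x y \<Longrightarrow> \<exists>i j. i < j \<and> j < length ws \<and> ws ! i = om x \<and> ws ! j = om y"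
    by (auto simp: JH_def)
  let ?xs = "map (inv_into P om) ws"
  have map: "map om ?xs = ws"
    using ws(2) by (auto intro!: map_idI simp: f_inv_into_f)
  have set: "set ?xs = P"
    using assms ws(2) by (simp add: image_image)
  have dist: "distinct ?xs"
    using ws(1) map distinct_map by metis
  have "sorted_wrt (\<lambda>x y. \<not> lt_on le y x) ?xs"
    unfolding sorted_wrt_iff_nth_less
  proof (intro allI impI notI)
    fix i j assume ij: "i < j" "j < length ?xs" "lt_on le (?xs ! j) (?xs ! i)"
    have "?xs ! i \<in> P" "?xs ! j \<in> P"
      using ij set nth_mem by (metis order.strict_trans)+
    then obtain k l where kl: "k < l" "l < length ws" "ws ! k = om (?xs ! j)" "ws ! l = om (?xs ! i)"
      using ord ij(3) by blast
    have "om (?xs ! j) = ws ! j" "om (?xs ! i) = ws ! i"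
      using ij map by (metis length_map nth_map order.strict_trans)+
    then have "k = j" "l = i"
      using kl ij ws(1) by (auto simp: nth_eq_iff_index_eq)
    then show False
      using ij kl by simp
  qed
  then have "?xs \<in> lin_ext P le"
    using dist set by (simp add: lin_ext_def)
  then show "ws \<in> map om ` lin_ext P le"
    using map by (metis imageI)
next
  fix ws assume "ws \<in> map om ` lin_ext P le"
  then obtain xs where xs: "ws = map om xs" "distinct xs" "set xs = P" "sorted_wrt (\<lambda>x y. \<not> lt_on le y x) xs"
    by (auto simp: lin_ext_def)
  have "\<exists>i j. i < j \<and> j < length ws \<and> ws ! i = om x \<and> ws ! j = om y"
    if xy: "x \<in> P" "y \<in> P" "lt_on le x y" for x y
  proof -
    obtain i j where ij: "i < length xs" "j < length xs" "xs ! i = x" "xs ! j = y"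
      using xy xs(3) by (metis in_set_conv_nth)
    have "i \<noteq> j"
      using ij xy by (auto simp: lt_on_def)
    moreover have "\<not> j < i"
      using xs(4) ij xy(3) by (auto simp: sorted_wrt_iff_nth_less)
    ultimately show ?thesis
      using ij xs(1) by (intro exI[of _ i] exI[of _ j]) auto
  qed
  then show "ws \<in> JH P le om"
    using xs assms by (auto simp: JH_def distinct_map)
qed

lemma sum_JH:
  assumes "inj_on om P"
  shows "(\<Sum>\<pi>\<in>JH P le om. f \<pi>) = (\<Sum>xs\<in>lin_ext P le. f (map om xs))"
proof -
  have "inj_on (map om) (lin_ext P le)"
    by (rule inj_onI, rule map_inj_on) (use assms in \<open>auto simp: lin_ext_def\<close>)
  then show ?thesis
    by (simp add: JH_eq_image_lin_ext[OF assms] sum.reindex)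
qed

lemma lin_ext_ends:
  assumes "xs \<in> lin_ext P le" "P \<noteq> {}"
  shows "minimal_in P le (hd xs)" "maximal_in P le (last xs)"
proof -
  have xs: "distinct xs" "set xs = P" "sorted_wrt (\<lambda>x y. \<not> lt_on le y x) xs" "xs \<noteq> []"
    using assms by (auto simp: lin_ext_def)
  obtain y ys where y: "xs = y # ys"
    using xs(4) by (cases xs) auto
  then show "minimal_in P le (hd xs)"
    using xs by (auto simp: minimal_in_def lt_on_def)
  obtain z zs where z: "xs = zs @ [z]"
    using xs(4) by (cases xs rule: rev_cases) auto
  then show "maximal_in P le (last xs)"
    using xs by (auto simp: maximal_in_def lt_on_def sorted_wrt_append)
qed

text \<open>The linear extensions are grouped by their runs; each group is a full product of
  permutations, to which the identity for \<open>words\<close> applies.\<close>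

lemma sum_lin_ext_des_eq_peak_weight:
  assumes P: "finite P" "P \<noteq> {}"
    and sign: "\<And>x. x \<in> P \<Longrightarrow> if s x then om1 x < 0 \<and> om2 x < 0 else 0 < om1 x \<and> 0 < om2 x"
    and inj: "inj_on om1 P" "inj_on om2 P"
    and betw: "\<And>x y. x \<in> P \<Longrightarrow> y \<in> P \<Longrightarrow> lt_on le x y \<Longrightarrow> s x = s y \<Longrightarrow>
      \<exists>z\<in>P. lt_on le x z \<and> lt_on le z y \<and> s z \<noteq> s x"
    and ends: "\<And>x. minimal_in P le x \<Longrightarrow> s x" "\<And>x. maximal_in P le x \<Longrightarrow> s x"
  shows "(\<Sum>xs\<in>lin_ext P le. t ^ des (map om1 xs)) =
    (\<Sum>xs\<in>lin_ext P le. peak_weight t False False (map om2 xs))"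
proof -
  let ?L = "lin_ext P le"
  have alt: "alternating s True (runs s xs)" if "xs \<in> ?L" for xs
  proof -
    have "xs \<noteq> []" using that P by (auto simp: lin_ext_def)
    then show ?thesis
      using alternating_runs[of xs s] ends lin_ext_ends[OF that P(2)] by auto
  qed
  have fibre: "{xs \<in> ?L. runs s xs = runs s ys} = words (runs s ys)" if ys: "ys \<in> ?L" for ys
  proof (intro equalityI subsetI)
    fix xs assume "xs \<in> {xs \<in> ?L. runs s xs = runs s ys}"
    then show "xs \<in> words (runs s ys)"
      using in_words_runs[of xs s] by (auto simp: lin_ext_def)
  next
    fix xs assume xs: "xs \<in> words (runs s ys)"
    have ys': "distinct ys" "set ys = P" "sorted_wrt (\<lambda>x y. \<not> lt_on le y x) ys"
      using ys by (auto simp: lin_ext_def)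
    have "sorted_wrt (\<lambda>x y. \<not> lt_on le y x) xs"
      using sorted_wrt_words_runs[OF xs ys'(1,3)] betw ys'(2) by auto
    then show "xs \<in> {xs \<in> ?L. runs s xs = runs s ys}"
      using words_runs_rearrangement[OF xs ys'(1)] ys'(2) runs_words[OF alt[OF ys] xs]
      by (simp add: lin_ext_def)
  qed
  have Un: "\<Union>(set (runs s ys)) = set ys" for ys
    by (induction ys rule: run_induct[where s = s]) simp_all
  have fin: "finite ?L"
    using P(1) by (rule finite_lin_ext)
  have "(\<Sum>xs\<in>?L. t ^ des (map om1 xs)) =
      (\<Sum>Cs\<in>runs s ` ?L. \<Sum>xs\<in>{xs \<in> ?L. runs s xs = Cs}. t ^ des (map om1 xs))"
    using fin by (rule sum.image_gen)
  also have "\<dots> = (\<Sum>Cs\<in>runs s ` ?L. \<Sum>xs\<in>{xs \<in> ?L. runs s xs = Cs}. peak_weight t False False (map om2 xs))"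
  proof (rule sum.cong[OF refl])
    fix Cs assume "Cs \<in> runs s ` ?L"
    then obtain ys where ys: "ys \<in> ?L" "Cs = runs s ys" by auto
    have U: "\<Union>(set Cs) = P"
      using ys Un by (auto simp: lin_ext_def)
    \<comment> \<open>A linear extension begins with a minimal element, so its first run is negative
      and the left flag is false.\<close>
    have "(\<Sum>xs\<in>words Cs. t ^ des (map om1 xs)) = (\<Sum>xs\<in>words Cs. peak_weight t (\<not> True) False (map om2 xs))"
      using alt[OF ys(1)] sign inj unfolding ys(2)[symmetric] U[symmetric]
      by (rule sum_words_des_eq_peak_weight)
    then show "(\<Sum>xs\<in>{xs \<in> ?L. runs s xs = Cs}. t ^ des (map om1 xs)) =
        (\<Sum>xs\<in>{xs \<in> ?L. runs s xs = Cs}. peak_weight t False False (map om2 xs))"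
      using fibre[OF ys(1)] ys(2) by simp
  qed
  also have "\<dots> = (\<Sum>xs\<in>?L. peak_weight t False False (map om2 xs))"
    using fin by (rule sum.image_gen[symmetric])
  finally show ?thesis .
qed

section \<open>Covers, saturated chains and the signs of canonical labels\<close>

lemma lt_on_trans:
  "poset_on P le \<Longrightarrow> x \<in> P \<Longrightarrow> y \<in> P \<Longrightarrow> z \<in> P \<Longrightarrow> lt_on le x y \<Longrightarrow> lt_on le y z \<Longrightarrow> lt_on le x z"
  unfolding poset_on_def lt_on_def by metis

text \<open>The size of the strict down-set is a strictly increasing measure, used below to choose
  extremal elements and for induction.\<close>

lemma down_card_less:
  assumes "finite P" "poset_on P le" "x \<in> P" "y \<in> P" "lt_on le x y"
  shows "card {z \<in> P. lt_on le z x} < card {z \<in> P. lt_on le z y}"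
proof (rule psubset_card_mono)
  show "{z \<in> P. lt_on le z x} \<subset> {z \<in> P. lt_on le z y}"
    using assms lt_on_trans[OF assms(2) _ assms(3,4)] by (auto simp: lt_on_def)
qed (use assms in auto)

text \<open>Among the elements above \<open>x\<close> and up to \<open>y\<close>, one with the
  smallest down-set covers \<open>x\<close>.\<close>

lemma ex_cover_above:
  assumes "finite P" "poset_on P le" "x \<in> P" "y \<in> P" "lt_on le x y"
  shows "\<exists>z. covers P le x z \<and> (z = y \<or> lt_on le z y)"
proof -
  let ?c = "\<lambda>u. card {z \<in> P. lt_on le z u}"
  obtain z where z: "z \<in> P \<and> lt_on le x z \<and> (z = y \<or> lt_on le z y)"
    and least: "\<And>w. w \<in> P \<and> lt_on le x w \<and> (w = y \<or> lt_on le w y) \<Longrightarrow> ?c z \<le> ?c w"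
    using ex_has_least_nat[of "\<lambda>z. z \<in> P \<and> lt_on le x z \<and> (z = y \<or> lt_on le z y)" y ?c] assms by blast
  have "\<not> (lt_on le x w \<and> lt_on le w z)" if "w \<in> P" for w
  proof
    assume w: "lt_on le x w \<and> lt_on le w z"
    then have "?c w < ?c z" "w = y \<or> lt_on le w y"
      using down_card_less[OF assms(1,2) that] z lt_on_trans[OF assms(2) that _ assms(4)] by auto
    then show False
      using least[of w] w that by auto
  qed
  then show ?thesis
    using z assms(3) by (auto simp: covers_def)
qed

text \<open>An element below \<open>x\<close> with the largest down-set is covered by
  \<open>x\<close>.\<close>

lemma ex_cover_below:
  assumes "finite P" "poset_on P le" "x \<in> P" "\<not> minimal_in P le x"
  shows "\<exists>y. covers P le y x"
proof -
  let ?A = "{y \<in> P. lt_on le y x}" and ?c = "\<lambda>u. card {z \<in> P. lt_on le z u}"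
  have "finite ?A" "?A \<noteq> {}"
    using assms by (auto simp: minimal_in_def)
  then have "Max (?c ` ?A) \<in> ?c ` ?A"
    by (intro Max_in) auto
  then obtain y where y: "y \<in> ?A" "Max (?c ` ?A) = ?c y"
    by (rule imageE)
  have greatest: "?c w \<le> ?c y" if "w \<in> ?A" for w
    unfolding y(2)[symmetric] using \<open>finite ?A\<close> that by (intro Max_ge) auto
  have "\<not> (lt_on le y w \<and> lt_on le w x)" if "w \<in> P" for w
    using greatest[of w] down_card_less[OF assms(1,2), of y w] y(1) that by auto
  then show ?thesis
    using y(1) assms(3) by (auto simp: covers_def)
qed

lemma ex_maximal:
  assumes "finite P" "poset_on P le" "P \<noteq> {}"
  shows "\<exists>x. maximal_in P le x"
proof -
  let ?c = "\<lambda>u. card {z \<in> P. lt_on le z u}"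
  have "Max (?c ` P) \<in> ?c ` P"
    using assms by (intro Max_in) auto
  then obtain x where x: "x \<in> P" "Max (?c ` P) = ?c x"
    by (rule imageE)
  have "\<not> lt_on le x y" if "y \<in> P" for y
  proof -
    have "?c y \<le> ?c x"
      unfolding x(2)[symmetric] using assms(1) that by (intro Max_ge) auto
    then show ?thesis
      using down_card_less[OF assms(1,2) x(1) that] by auto
  qed
  then show ?thesis
    using x(1) by (auto simp: maximal_in_def)
qed

lemma sat_chain_snoc:
  assumes "sat_chain_from_min P le xs" "covers P le (last xs) z"
  shows "sat_chain_from_min P le (xs @ [z])"
proof -
  have "covers P le ((xs @ [z]) ! i) ((xs @ [z]) ! Suc i)" if "Suc i < length (xs @ [z])" for i
  proof (cases "Suc i = length xs")
    case True
    then have "xs ! i = last xs" "i < length xs"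
      using last_conv_nth[of xs] assms(1) by (auto simp: sat_chain_from_min_def simp flip: True)
    then show ?thesis
      using assms(2) True by (simp add: nth_append)
  next
    case False
    then show ?thesis
      using that assms(1) by (auto simp: nth_append sat_chain_from_min_def)
  qed
  then show ?thesis
    using assms(1) by (auto simp: sat_chain_from_min_def)
qed

lemma ex_sat_chain:
  assumes "finite P" "poset_on P le" "x \<in> P"
  shows "\<exists>xs. sat_chain_from_min P le xs \<and> last xs = x"
  using assms(3)
proof (induction "card {z \<in> P. lt_on le z x}" arbitrary: x rule: less_induct)
  case less
  show ?case
  proof (cases "minimal_in P le x")
    case True
    then have "sat_chain_from_min P le [x]"
      by (simp add: sat_chain_from_min_def)
    then show ?thesis
      by (metis last_ConsL)
  next
    case False
    then obtain y where y: "covers P le y x"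
      using ex_cover_below[OF assms(1,2) less.prems] by blast
    then have "y \<in> P" "lt_on le y x"
      by (auto simp: covers_def)
    then obtain ys where "sat_chain_from_min P le ys" "last ys = y"
      using less.hyps[of y] down_card_less[OF assms(1,2) \<open>y \<in> P\<close> less.prems] by blast
    then show ?thesis
      using sat_chain_snoc[of P le ys x] y by (metis last_snoc)
  qed
qed

text \<open>Each cover changes the chain sum by 1 or -1, so the length of the chain decides between
  the values 0 and 1. The sign is thereby expressed without the labeling, so any two canonical
  labelings agree in sign.\<close>

lemma canonical_sign_parity:
  assumes "canonical P le om" "sat_chain_from_min P le xs"
  shows "if odd (length xs) then om (last xs) < 0 else 0 < om (last xs)"
proof -
  have "even (\<Sum>i<n. eps om (xs ! i) (xs ! Suc i)) \<longleftrightarrow> even n" for n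
    by (induction n) (auto simp: eps_def)
  then have "even (chain_sum om xs) \<longleftrightarrow> odd (length xs)"
    using assms(2) by (cases xs) (auto simp: chain_sum_def sat_chain_from_min_def)
  moreover have "(chain_sum om xs = 0 \<and> om (last xs) < 0) \<or> (chain_sum om xs = 1 \<and> om (last xs) > 0)"
    using assms by (simp add: canonical_def)
  ultimately show ?thesis
    by auto
qed

lemma canonicalD:
  assumes "canonical P le om"
  shows "finite P" "poset_on P le" "inj_on om P"
  using assms by (auto simp: canonical_def labeled_poset_def)

lemma canonical_nonzero: "canonical P le om \<Longrightarrow> x \<in> P \<Longrightarrow> om x \<noteq> 0"
  using ex_sat_chain canonical_sign_parity canonicalD
  by (metis less_irrefl)

lemma canonical_minimal_neg: "canonical P le om \<Longrightarrow> minimal_in P le x \<Longrightarrow> om x < 0"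
  using canonical_sign_parity[of P le om "[x]"] by (simp add: sat_chain_from_min_def)

lemma canonical_cover_sign:
  assumes "canonical P le om" "covers P le x y"
  shows "om y < 0 \<longleftrightarrow> \<not> om x < 0"
proof -
  have "x \<in> P"
    using assms(2) by (simp add: covers_def)
  then obtain xs where xs: "sat_chain_from_min P le xs" "last xs = x"
    using ex_sat_chain[OF canonicalD(1,2)[OF assms(1)]] by blast
  then have "sat_chain_from_min P le (xs @ [y])"
    using assms(2) sat_chain_snoc by metis
  then show ?thesis
    using canonical_sign_parity[OF assms(1) xs(1)] canonical_sign_parity[OF assms(1), of "xs @ [y]"] xs(2)
    by (auto split: if_splits)
qed

text \<open>The witness is a cover of \<open>x\<close> on the way to \<open>y\<close>: its sign is
  opposite to that of \<open>x\<close>, so it is not \<open>y\<close>.\<close>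

lemma canonical_between:
  assumes "canonical P le om" "x \<in> P" "y \<in> P" "lt_on le x y" "(om x < 0) = (om y < 0)"
  shows "\<exists>z\<in>P. lt_on le x z \<and> lt_on le z y \<and> (om z < 0) \<noteq> (om x < 0)"
proof -
  obtain z where z: "covers P le x z" "z = y \<or> lt_on le z y"
    using ex_cover_above[OF canonicalD(1,2)[OF assms(1)] assms(2-4)] by blast
  then show ?thesis
    using canonical_cover_sign[OF assms(1) z(1)] assms(5) by (auto simp: covers_def)
qed

lemma canonical_maximal_sign:
  assumes "canonical P le om" "sign_graded P le om r" "maximal_in P le x"
  shows "r = 0 \<and> om x < 0 \<or> r = 1 \<and> 0 < om x"
proof -
  have "x \<in> P"
    using assms(3) by (simp add: maximal_in_def)
  then obtain xs where xs: "sat_chain_from_min P le xs" "last xs = x"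
    using ex_sat_chain[OF canonicalD(1,2)[OF assms(1)]] by blast
  then have "chain_sum om xs = r"
    using assms(2,3) by (auto simp: sign_graded_def maximal_chain_def)
  then show ?thesis
    using assms(1) xs by (auto simp: canonical_def)
qed

section \<open>Adjoining a greatest element\<close>

lemma lt_on_hatle [simp]:
  "lt_on (hatle le) (Some a) (Some b) \<longleftrightarrow> lt_on le a b"
  "lt_on (hatle le) (Some a) None"
  "\<not> lt_on (hatle le) None x"
  by (auto simp: lt_on_def hatle_def) (metis not_None_eq)

lemma covers_hat_Some [simp]:
  "covers (hatP P) (hatle le) (Some a) (Some b) \<longleftrightarrow> covers P le a b"
  by (auto simp: covers_def hatP_def)

lemma sat_chain_hat:
  assumes "sat_chain_from_min P le xs"
  shows "sat_chain_from_min (hatP P) (hatle le) (map Some xs)"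
proof -
  have "minimal_in (hatP P) (hatle le) (Some (hd xs))"
    using assms by (auto simp: sat_chain_from_min_def minimal_in_def hatP_def)
  then show ?thesis
    using assms by (auto simp: sat_chain_from_min_def hd_map)
qed

lemma lin_ext_hat: "lin_ext (hatP P) (hatle le) = (\<lambda>xs. map Some xs @ [None]) ` lin_ext P le"
proof (intro equalityI subsetI)
  fix ys assume "ys \<in> lin_ext (hatP P) (hatle le)"
  then have ys: "distinct ys" "set ys = hatP P" "sorted_wrt (\<lambda>x y. \<not> lt_on (hatle le) y x) ys"
    by (auto simp: lin_ext_def)
  have "ys \<noteq> []"
    using ys(2) by (auto simp: hatP_def)
  then obtain zs z where z: "ys = zs @ [z]"
    by (cases ys rule: rev_cases) auto
  have "z = None"
  proof (rule ccontr)
    assume "z \<noteq> None"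
    then have "None \<in> set zs"
      using ys(2) z by (auto simp: hatP_def)
    then show False
      using ys(3) z \<open>z \<noteq> None\<close> by (auto simp: sorted_wrt_append)
  qed
  then have "set zs = Some ` P"
    using ys(1,2) z insert_ident[of None "set zs" "Some ` P"] by (auto simp: hatP_def)
  then obtain xs where xs: "zs = map Some xs" "set xs = P"
    by (metis (no_types, lifting) ex_map_conv image_iff image_set inj_Some inj_image_eq_iff)
  then have "xs \<in> lin_ext P le"
    using ys z by (auto simp: lin_ext_def sorted_wrt_append sorted_wrt_map distinct_map)
  then show "ys \<in> (\<lambda>xs. map Some xs @ [None]) ` lin_ext P le"
    using z xs \<open>z = None\<close> by auto
next
  fix ys assume "ys \<in> (\<lambda>xs. map Some xs @ [None]) ` lin_ext P le"
  then show "ys \<in> lin_ext (hatP P) (hatle le)"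
    by (auto simp: lin_ext_def sorted_wrt_append sorted_wrt_map distinct_map hatP_def)
qed

section \<open>From sums over words to counts by number of peaks\<close>

lemma sum_by_value:
  fixes F :: "nat \<Rightarrow> real"
  assumes "finite X" "\<And>x. x \<in> X \<Longrightarrow> g x \<le> N"
  shows "(\<Sum>x\<in>X. F (g x)) = (\<Sum>i\<le>N. real (card {x \<in> X. g x = i}) * F i)"
proof -
  have "(\<Sum>x\<in>X. F (g x)) = (\<Sum>i\<le>N. \<Sum>x\<in>{x \<in> X. g x = i}. F (g x))"
    using assms by (intro sum.group[symmetric]) auto
  also have "\<dots> = (\<Sum>i\<le>N. real (card {x \<in> X. g x = i}) * F i)"
    by (intro sum.cong) simp_all
  finally show ?thesis .
qed

lemma length_JH: "inj_on om P \<Longrightarrow> \<pi> \<in> JH P le om \<Longrightarrow> length \<pi> = card P"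
  using distinct_card[of \<pi>] card_image[of om P] by (simp add: JH_def)

lemma finite_JH: "finite P \<Longrightarrow> inj_on om P \<Longrightarrow> finite (JH P le om)"
  by (simp add: JH_eq_image_lin_ext finite_lin_ext)

lemma peak_JH_le:
  assumes "inj_on om P" "finite P" "P \<noteq> {}" "\<pi> \<in> JH P le om"
  shows "2 * peak \<pi> + 1 \<le> card P"
proof -
  have "length \<pi> = card P"
    using assms by (intro length_JH)
  moreover from this have "\<pi> \<noteq> []"
    using assms by auto
  ultimately show ?thesis
    using ctx_peak_le[of \<pi> False False] by (simp add: peak_eq_ctx_peak)
qed

lemma sum_peak_weight_JH:
  assumes "inj_on om P"
  shows "(\<Sum>xs\<in>lin_ext P le. peak_weight t False False (map om xs)) =
    (\<Sum>\<pi>\<in>JH P le om. ((1 + t) / 2) ^ (card P - 1 - 2 * peak \<pi>) * t ^ peak \<pi>)"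
  unfolding sum_JH[OF assms, symmetric]
  using length_JH[OF assms] by (intro sum.cong) (auto simp: peak_weight_def peak_eq_ctx_peak)

text \<open>With \<open>s = (1 + t) / 2\<close> the argument equals \<open>t / s^2\<close>, so each
  peak consumes two of the \<open>n\<close> factors \<open>s\<close>.\<close>

lemma power_peak_rewrite:
  fixes t :: real
  assumes "t \<noteq> -1" "2 * k \<le> n"
  shows "(1 + t) ^ n / 2 ^ n * (4 * t / (1 + t)\<^sup>2) ^ k = ((1 + t) / 2) ^ (n - 2 * k) * t ^ k"
proof -
  have nz: "(1 + t) / 2 \<noteq> 0"
    using assms(1) by simp
  have "4 * t / (1 + t)\<^sup>2 = t / ((1 + t) / 2)\<^sup>2"
    by (simp add: power2_eq_square)
  then show ?thesis
    using nz assms(2) by (simp add: power_divide[of t] power_diff power_mult flip: power_divide[of "1 + t" 2 n])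
qed

lemma powi_two_diff: "k \<le> n \<Longrightarrow> (2::real) powi (int k - int n) = 1 / 2 ^ (n - k)"
  by (simp add: power_int_diff power_diff)

text \<open>Recovers the value at 0 of an identity obtained by cancelling a factor
  \<open>t\<close>.\<close>

lemma continuous_eq_at_zero:
  fixes f g :: "real \<Rightarrow> real"
  assumes "isCont f 0" "isCont g 0" "\<And>t. t \<noteq> 0 \<Longrightarrow> f t = g t"
  shows "f t = g t"
proof (cases "t = 0")
  case True
  have "f \<midarrow>0\<rightarrow> f 0" "g \<midarrow>0\<rightarrow> g 0"
    using assms(1,2) by (auto simp: isCont_def)
  moreover have "f \<midarrow>0\<rightarrow> g 0"
    using calculation(2) assms(3) LIM_equal[of 0 f g] by auto
  ultimately show ?thesis
    using True LIM_unique by blast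
qed (use assms in auto)

text \<open>In rank 0 minimal and maximal elements are negative, so every word begins and ends with
  a negative run; both labelings are taken to be \<open>om\<close>.\<close>

lemma W_rank_zero:
  assumes "P \<noteq> {}" "canonical P le om" "sign_graded P le om 0"
  shows "W P le om t = (\<Sum>\<pi>\<in>JH P le om. ((1 + t) / 2) ^ (card P - 1 - 2 * peak \<pi>) * t ^ peak \<pi>)"
proof -
  note can = canonicalD[OF assms(2)]
  have "W P le om t = (\<Sum>xs\<in>lin_ext P le. t ^ des (map om xs))"
    unfolding W_def by (rule sum_JH[OF can(3)])
  also have "\<dots> = (\<Sum>xs\<in>lin_ext P le. peak_weight t False False (map om xs))"
  proof (rule sum_lin_ext_des_eq_peak_weight[where s = "\<lambda>x. om x < 0"])
    show "if om x < 0 then om x < 0 \<and> om x < 0 else 0 < om x \<and> 0 < om x" if "x \<in> P" for x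
      using canonical_nonzero[OF assms(2) that] by auto
    show "om x < 0" if "maximal_in P le x" for x
      using canonical_maximal_sign[OF assms(2,3) that] by simp
    show "\<exists>z\<in>P. lt_on le x z \<and> lt_on le z y \<and> (om z < 0) \<noteq> (om x < 0)"
      if "x \<in> P" "y \<in> P" "lt_on le x y" "(om x < 0) = (om y < 0)" for x y
      using assms(2) that by (rule canonical_between)
    show "om x < 0" if "minimal_in P le x" for x
      using assms(2) that by (rule canonical_minimal_neg)
  qed (fact can assms(1))+
  finally show ?thesis
    by (simp add: sum_peak_weight_JH[OF can(3)])
qed

text \<open>In rank 1 maximal elements are positive, so words of \<open>P\<close> end with a
  positive run; the adjoined greatest element supplies the final negative run.\<close>

lemma W_rank_one:
  assumes "P \<noteq> {}" "canonical P le om" "sign_graded P le om 1" "canonical (hatP P) (hatle le) hom"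
  shows "t * W P le om t =
    (\<Sum>\<pi>\<in>JH (hatP P) (hatle le) hom. ((1 + t) / 2) ^ (card P - 2 * peak \<pi>) * t ^ peak \<pi>)"
proof -
  note can = canonicalD[OF assms(2)] and hcan = canonicalD[OF assms(4)]
  \<comment> \<open>A negative label different from all labels of \<open>P\<close>, intended for the
    greatest element.\<close>
  define M where "M = Min (insert 0 (om ` P)) - 1"
  have "M < m" if "m \<in> insert 0 (om ` P)" for m
  proof -
    have "Min (insert 0 (om ` P)) \<le> m"
      using can(1) that by (intro Min_le) auto
    then show ?thesis
      by (simp add: M_def)
  qed
  then have M: "M < 0" "M \<notin> om ` P"
    by auto
  let ?om = "case_option M om" and ?s = "\<lambda>x. hom x < 0"
  \<comment> \<open>A saturated chain of \<open>P\<close> remains one, of the same length, in the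
    extended poset; the parity of its length gives both signs.\<close>
  have sign: "hom (Some x) < 0 \<longleftrightarrow> om x < 0" if x: "x \<in> P" for x
  proof -
    obtain xs where xs: "sat_chain_from_min P le xs" "last xs = x"
      using ex_sat_chain[OF can(1,2) x] by blast
    then have "last (map Some xs) = Some x"
      by (subst last_map) (auto simp: sat_chain_from_min_def)
    then show ?thesis
      using canonical_sign_parity[OF assms(2) xs(1)] canonical_sign_parity[OF assms(4) sat_chain_hat[OF xs(1)]] xs(2)
      by (auto split: if_splits)
  qed
  have max_pos: "0 < om x" if "maximal_in P le x" for x
    using canonical_maximal_sign[OF assms(2,3) that] by simp
  have "hom None < 0"
  proof -
    obtain x where "maximal_in P le x"
      using ex_maximal[OF can(1,2) assms(1)] by blast
    moreover from this have "x \<in> P"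
      by (simp add: maximal_in_def)
    ultimately have "covers (hatP P) (hatle le) (Some x) None" "0 < om x"
      using max_pos by (auto simp: covers_def hatP_def maximal_in_def)
    then show ?thesis
      using canonical_cover_sign[OF assms(4)] sign[OF \<open>x \<in> P\<close>] by auto
  qed
  have "t * W P le om t = (\<Sum>xs\<in>lin_ext P le. t * t ^ des (map om xs))"
    unfolding W_def by (simp add: sum_JH[OF can(3)] sum_distrib_left)
  \<comment> \<open>The last letter is positive and \<open>M\<close> negative, so appending
    \<open>M\<close> adds exactly one descent.\<close>
  also have "\<dots> = (\<Sum>xs\<in>lin_ext P le. t ^ des (map ?om (map Some xs @ [None])))"
  proof (rule sum.cong[OF refl])
    fix xs assume xs: "xs \<in> lin_ext P le"
    then have "xs \<noteq> []" "0 < om (last xs)"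
      using assms(1) max_pos[OF lin_ext_ends(2)[OF xs assms(1)]] by (auto simp: lin_ext_def)
    then show "t * t ^ des (map om xs) = t ^ des (map ?om (map Some xs @ [None]))"
      using M(1) by (simp add: des_append last_map o_def)
  qed
  also have "\<dots> = (\<Sum>xs\<in>lin_ext (hatP P) (hatle le). t ^ des (map ?om xs))"
  proof -
    have "inj_on (\<lambda>xs. map Some xs @ [None]) (lin_ext P le)"
      by (auto simp: inj_on_def inj_map_eq_map)
    then show ?thesis
      unfolding lin_ext_hat by (simp add: sum.reindex)
  qed
  \<comment> \<open>Here the labeling changes: descents are read in \<open>?om\<close>, peaks in the
    given \<open>hom\<close>, which has the same signs.\<close>
  also have "\<dots> = (\<Sum>xs\<in>lin_ext (hatP P) (hatle le). peak_weight t False False (map hom xs))"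
  proof (rule sum_lin_ext_des_eq_peak_weight[where s = ?s])
    show "finite (hatP P)" "inj_on hom (hatP P)" by fact+
    show "hatP P \<noteq> {}" by (simp add: hatP_def)
    show "inj_on ?om (hatP P)"
      using can(3) M(2) by (auto simp: hatP_def inj_on_def)
    show "if ?s x then ?om x < 0 \<and> hom x < 0 else 0 < ?om x \<and> 0 < hom x" if x: "x \<in> hatP P" for x
    proof (cases x)
      case None
      then show ?thesis using M(1) \<open>hom None < 0\<close> by simp
    next
      case (Some y)
      then have y: "y \<in> P" using x by (auto simp: hatP_def)
      then show ?thesis
        using Some sign[OF y] canonical_nonzero[OF assms(2) y] canonical_nonzero[OF assms(4) x] by auto
    qed
    show "hom x < 0" if "maximal_in (hatP P) (hatle le) x" for x
      using that \<open>hom None < 0\<close> by (cases x) (auto simp: maximal_in_def hatP_def)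
    show "\<exists>z\<in>hatP P. lt_on (hatle le) x z \<and> lt_on (hatle le) z y \<and> ?s z \<noteq> ?s x"
      if "x \<in> hatP P" "y \<in> hatP P" "lt_on (hatle le) x y" "?s x = ?s y" for x y
      using assms(4) that by (rule canonical_between)
  qed (rule canonical_minimal_neg[OF assms(4)])
  also have "card (hatP P) = Suc (card P)"
    using can(1) by (auto simp: hatP_def card_image)
  then have "(\<Sum>xs\<in>lin_ext (hatP P) (hatle le). peak_weight t False False (map hom xs)) =
    (\<Sum>\<pi>\<in>JH (hatP P) (hatle le) hom. ((1 + t) / 2) ^ (card P - 2 * peak \<pi>) * t ^ peak \<pi>)"
    using sum_peak_weight_JH[OF hcan(3)] by simp
  finally show ?thesis .
qed

section \<open>Peak identities and coefficients in ranks 0 and 1\<close>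

theorem theorem6p4:
  fixes P :: "'a set" and le :: "'a \<Rightarrow> 'a \<Rightarrow> bool" and om :: "'a \<Rightarrow> int" and r :: int
  assumes "P \<noteq> {}"
    and "canonical P le om"
    and "sign_graded P le om r"
  shows "(r = 0 \<longrightarrow>
           (\<forall>t::real. t \<noteq> -1 \<longrightarrow>
              W P le om t = (1 + t) ^ (card P - 1) / 2 ^ (card P - 1)
                 * Wbar P le om (4 * t / (1 + t)^2)) \<and>
           (\<forall>t::real. W P le om t =
              (\<Sum>i\<le>(card P - 1) div 2.
                 (2::real) powi (2 * int i - int (card P) + 1)
                 * real (card {\<pi>\<in>JH P le om. peak \<pi> = i})
                 * t ^ i * (1 + t) ^ (card P - 1 - 2 * i))))
       \<and> (r = 1 \<longrightarrow>
           (\<forall>hom. canonical (hatP P) (hatle le) hom \<longrightarrow>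
              (\<forall>t::real. t \<noteq> 0 \<and> t \<noteq> -1 \<longrightarrow>
                 W P le om t = (1 + t) ^ card P / (2 ^ card P * t)
                    * Wbar (hatP P) (hatle le) hom (4 * t / (1 + t)^2)) \<and>
              (\<forall>t::real. W P le om t =
                 (\<Sum>i\<le>(card P - 2) div 2.
                    (2::real) powi (2 * int i - int (card P) + 2)
                    * real (card {\<pi>\<in>JH (hatP P) (hatle le) hom. peak \<pi> = i + 1})
                    * t ^ i * (1 + t) ^ (card P - 2 - 2 * i)))))"
proof (intro conjI impI allI)
  note can = canonicalD[OF assms(2)]
  have card_pos: "1 \<le> card P"
    using assms(1) can(1) by (simp add: Suc_le_eq card_gt_0_iff)
  {
    assume "r = 0"
    note W0 = W_rank_zero[OF assms(1,2) assms(3)[unfolded \<open>r = 0\<close>]]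
    have le: "2 * peak \<pi> \<le> card P - 1" if "\<pi> \<in> JH P le om" for \<pi>
      using peak_JH_le[OF can(3,1) assms(1) that] by simp
    show "W P le om t = (1 + t) ^ (card P - 1) / 2 ^ (card P - 1) * Wbar P le om (4 * t / (1 + t)^2)"
      if "t \<noteq> -1" for t
      unfolding W0 Wbar_def sum_distrib_left
      using power_peak_rewrite[OF that le] by (intro sum.cong) simp_all
    show "W P le om t = (\<Sum>i\<le>(card P - 1) div 2. (2::real) powi (2 * int i - int (card P) + 1)
        * real (card {\<pi>\<in>JH P le om. peak \<pi> = i}) * t ^ i * (1 + t) ^ (card P - 1 - 2 * i))" for t
    proof -
      have "W P le om t = (\<Sum>i\<le>(card P - 1) div 2. real (card {\<pi>\<in>JH P le om. peak \<pi> = i}) *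
          (((1 + t) / 2) ^ (card P - 1 - 2 * i) * t ^ i))"
        unfolding W0
      proof (rule sum_by_value[OF finite_JH[OF can(1,3)]])
        show "peak \<pi> \<le> (card P - 1) div 2" if "\<pi> \<in> JH P le om" for \<pi>
          using le[OF that] by simp
      qed
      also have "\<dots> = (\<Sum>i\<le>(card P - 1) div 2. (2::real) powi (2 * int i - int (card P) + 1)
        * real (card {\<pi>\<in>JH P le om. peak \<pi> = i}) * t ^ i * (1 + t) ^ (card P - 1 - 2 * i))"
      proof (rule sum.cong[OF refl])
        fix i assume "i \<in> {..(card P - 1) div 2}"
        then have i: "2 * i \<le> card P - 1" by auto
        have "2 * int i - int (card P) + 1 = int (2 * i) - int (card P - 1)"
          using card_pos by simp
        then have "(2::real) powi (2 * int i - int (card P) + 1) = 1 / 2 ^ (card P - 1 - 2 * i)"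
          using powi_two_diff[OF i] by (simp only:)
        then show "real (card {\<pi>\<in>JH P le om. peak \<pi> = i}) * (((1 + t) / 2) ^ (card P - 1 - 2 * i) * t ^ i) =
          (2::real) powi (2 * int i - int (card P) + 1)
          * real (card {\<pi>\<in>JH P le om. peak \<pi> = i}) * t ^ i * (1 + t) ^ (card P - 1 - 2 * i)"
          by (simp add: power_divide)
      qed
      finally show ?thesis .
    qed
  }
  fix hom assume "r = 1" and hom: "canonical (hatP P) (hatle le) hom"
  note W1 = W_rank_one[OF assms(1,2) assms(3)[unfolded \<open>r = 1\<close>] hom]
  note hcan = canonicalD[OF hom]
  \<comment> \<open>A single element would be both minimal, hence negative, and maximal, hence
    positive in rank 1. So \<open>card P - 2\<close> does not truncate.\<close>
  have card_ge_2: "2 \<le> card P"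
  proof (rule ccontr)
    assume "\<not> 2 \<le> card P"
    then obtain x where "P = {x}"
      using card_pos by (metis One_nat_def Suc_1 card_1_singletonE le_antisym not_less_eq_eq)
    then have "minimal_in P le x" "maximal_in P le x"
      by (auto simp: minimal_in_def maximal_in_def lt_on_def)
    then show False
      using canonical_minimal_neg[OF assms(2)] canonical_maximal_sign[OF assms(2,3)] \<open>r = 1\<close> by force
  qed
  let ?J = "JH (hatP P) (hatle le) hom"
  have fin: "finite ?J"
    using hcan finite_JH by blast
  have "card (hatP P) = Suc (card P)"
    using can(1) by (auto simp: hatP_def card_image)
  then have le: "2 * peak \<pi> \<le> card P" if "\<pi> \<in> ?J" for \<pi>
    using peak_JH_le[OF hcan(3,1) _ that] by (simp add: hatP_def)
  \<comment> \<open>At 0 the left-hand side of the rank-one identity vanishes, while a word without peaks would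
    contribute a positive term to the right-hand side.\<close>
  have peak_pos: "1 \<le> peak \<pi>" if "\<pi> \<in> ?J" for \<pi>
  proof (rule ccontr)
    assume "\<not> 1 \<le> peak \<pi>"
    then have "peak \<pi> = 0"
      by simp
    then have "0 < (\<Sum>\<pi>\<in>?J. ((1 + 0) / 2) ^ (card P - 2 * peak \<pi>) * 0 ^ peak \<pi> :: real)"
      using that fin by (intro sum_pos2[of _ \<pi>]) auto
    then show False
      using W1[of 0] by simp
  qed
  show "W P le om t = (1 + t) ^ card P / (2 ^ card P * t) * Wbar (hatP P) (hatle le) hom (4 * t / (1 + t)^2)"
    if t: "t \<noteq> 0 \<and> t \<noteq> -1" for t
  proof -
    have "t * W P le om t = (1 + t) ^ card P / 2 ^ card P * Wbar (hatP P) (hatle le) hom (4 * t / (1 + t)^2)"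
      unfolding W1 Wbar_def sum_distrib_left
      using power_peak_rewrite[OF _ le] t by (intro sum.cong) simp_all
    then show ?thesis
      using t by (simp add: field_simps)
  qed
  show "W P le om t = (\<Sum>i\<le>(card P - 2) div 2. (2::real) powi (2 * int i - int (card P) + 2)
      * real (card {\<pi>\<in>?J. peak \<pi> = i + 1}) * t ^ i * (1 + t) ^ (card P - 2 - 2 * i))" for t
  proof -
    \<comment> \<open>Every word has a peak, so each summand contains a factor \<open>t\<close> that
      can be cancelled for nonzero \<open>t\<close>; continuity covers 0.\<close>
    have "W P le om t = (\<Sum>\<pi>\<in>?J. ((1 + t) / 2) ^ (card P - 2 - 2 * (peak \<pi> - 1)) * t ^ (peak \<pi> - 1))"
    proof (rule continuous_eq_at_zero[where f = "W P le om" and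
          g = "\<lambda>t. \<Sum>\<pi>\<in>?J. ((1 + t) / 2) ^ (card P - 2 - 2 * (peak \<pi> - 1)) * t ^ (peak \<pi> - 1)"])
      show "isCont (W P le om) 0"
        unfolding W_def by (intro continuous_intros)
      show "isCont (\<lambda>t::real. \<Sum>\<pi>\<in>?J. ((1 + t) / 2) ^ (card P - 2 - 2 * (peak \<pi> - 1)) * t ^ (peak \<pi> - 1)) 0"
        by (intro continuous_intros) simp
      fix t :: real assume "t \<noteq> 0"
      have "t * W P le om t = t * (\<Sum>\<pi>\<in>?J. ((1 + t) / 2) ^ (card P - 2 - 2 * (peak \<pi> - 1)) * t ^ (peak \<pi> - 1))"
        unfolding W1 sum_distrib_left
      proof (rule sum.cong[OF refl])
        fix \<pi> assume "\<pi> \<in> ?J"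
        then obtain k where "peak \<pi> = Suc k"
          using peak_pos[of \<pi>] by (cases "peak \<pi>") auto
        then show "((1 + t) / 2) ^ (card P - 2 * peak \<pi>) * t ^ peak \<pi> =
            t * (((1 + t) / 2) ^ (card P - 2 - 2 * (peak \<pi> - 1)) * t ^ (peak \<pi> - 1))"
          by simp
      qed
      then show "W P le om t = (\<Sum>\<pi>\<in>?J. ((1 + t) / 2) ^ (card P - 2 - 2 * (peak \<pi> - 1)) * t ^ (peak \<pi> - 1))"
        using \<open>t \<noteq> 0\<close> by simp
    qed
    also have "\<dots> = (\<Sum>i\<le>(card P - 2) div 2. real (card {\<pi>\<in>?J. peak \<pi> - 1 = i}) *
          (((1 + t) / 2) ^ (card P - 2 - 2 * i) * t ^ i))"
    proof (rule sum_by_value[OF fin])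
      show "peak \<pi> - 1 \<le> (card P - 2) div 2" if "\<pi> \<in> ?J" for \<pi>
        using le[OF that] by simp
    qed
    also have "\<dots> = (\<Sum>i\<le>(card P - 2) div 2. (2::real) powi (2 * int i - int (card P) + 2)
      * real (card {\<pi>\<in>?J. peak \<pi> = i + 1}) * t ^ i * (1 + t) ^ (card P - 2 - 2 * i))"
    proof (rule sum.cong[OF refl])
      fix i assume "i \<in> {..(card P - 2) div 2}"
      then have i: "2 * i \<le> card P - 2" by auto
      \<comment> \<open>Truncated subtraction would also send words without peaks to
        \<open>i = 0\<close>; there are none.\<close>
      have eq: "{\<pi>\<in>?J. peak \<pi> - 1 = i} = {\<pi>\<in>?J. peak \<pi> = i + 1}"
        using peak_pos by force
      have "2 * int i - int (card P) + 2 = int (2 * i) - int (card P - 2)"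
        using card_ge_2 by simp
      then have "(2::real) powi (2 * int i - int (card P) + 2) = 1 / 2 ^ (card P - 2 - 2 * i)"
        using powi_two_diff[OF i] by (simp only:)
      then show "real (card {\<pi>\<in>?J. peak \<pi> - 1 = i}) * (((1 + t) / 2) ^ (card P - 2 - 2 * i) * t ^ i) =
        (2::real) powi (2 * int i - int (card P) + 2)
        * real (card {\<pi>\<in>?J. peak \<pi> = i + 1}) * t ^ i * (1 + t) ^ (card P - 2 - 2 * i)"
        unfolding eq by (simp add: power_divide)
    qed
    finally show ?thesis .
  qed
qed

end
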